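(* There is a commutative Noetherian ring $S$ with prime ideals $\mathfrak P\subsetneq\mathfrak Q$ such that $\operatorname{ht}(\mathfrak Q)=\operatorname{ht}(\mathfrak P)+1$, but \[ \operatorname{K.grade}_S(\mathfrak Q,S)>\operatorname{K.grade}_S(\mathfrak P,S)+1. \] More precisely, one may arrange $\operatorname{K.grade}_S(\mathfrak P,S)=0$ and $\operatorname{K.grade}_S(\mathfrak Q,S)=2$.
   Context: All rings are commutative with identity. Here $\operatorname{ht}$ denotes the height of a prime ideal. For a ring $A$, an $A$-module $N$ and a finite sequence $\mathbf a=a_1,\ldots,a_s$ in $A$, let $K_\bullet(\mathbf a;A)$ be the Koszul complex and $K^\bullet(\mathbf a;N)=\operatorname{Hom}_A(K_\bullet(\mathbf a;A),N)$. If $I=(\mathbf a)$, the Koszul grade of $I$ on $N$ is \[ \operatorname{K.grade}_A(I,N)=\inf\{i\geq 0\mid H^i(K^\bullet(\mathbf a;N))\neq 0\}, \] with $\inf\varnothing=\infty$; it is independent of the chosen finite generating sequence. For an arbitrary ideal $J$, $\operatorname{K.grade}_A(J,N)=\sup\{\operatorname{K.grade}_A(I,N)\mid I\subseteq J\text{ a finitely generated ideal}\}$. *)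

theory Defs
  imports
    "HOL-Computational_Algebra.Polynomial"
    "HOL-Algebra.Module"
    "HOL-Algebra.Coset"
    "HOL-Algebra.Ring_Divisibility"
    "HOL-Library.Extended_Nat"
    "HOL-Library.FuncSet"
begin

definition prime_height :: "('a, 'm) ring_scheme \<Rightarrow> 'a set \<Rightarrow> enat" where
  "prime_height A P =
     Sup {enat n | n. \<exists>c :: nat \<Rightarrow> 'a set.
        (\<forall>i\<le>n. primeideal (c i) A) \<and> (\<forall>i<n. c i \<subset> c (Suc i)) \<and> c n = P}"

text \<open>
  Elements of a module of functions, and homomorphisms, are extensional functions, so that
  HOL equality is equality of elements. The ring fields \<^const>\<open>mult\<close> and
  \<^const>\<open>one\<close> of the record \<^type>\<open>module_ext\<close> play no role for a module and
  are left \<^const>\<open>undefined\<close>.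
\<close>

definition self_module :: "('a, 'm) ring_scheme \<Rightarrow> ('a, 'a) module" where
  "self_module A =
     \<lparr>carrier = carrier A, monoid.mult = mult A, one = one A, zero = zero A, add = add A,
      smult = mult A\<rparr>"

definition free_module :: "('a, 'm) ring_scheme \<Rightarrow> 'i set \<Rightarrow> ('a, 'i \<Rightarrow> 'a) module" where
  "free_module A X =
     \<lparr>carrier = X \<rightarrow>\<^sub>E carrier A, monoid.mult = undefined, one = undefined,
      zero = (\<lambda>x\<in>X. \<zero>\<^bsub>A\<^esub>),
      add = (\<lambda>f g. \<lambda>x\<in>X. f x \<oplus>\<^bsub>A\<^esub> g x),
      smult = (\<lambda>r f. \<lambda>x\<in>X. r \<otimes>\<^bsub>A\<^esub> f x)\<rparr>"

definition Hom_module ::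
  "('a, 'm) ring_scheme \<Rightarrow> ('a, 'b, 'k) module_scheme \<Rightarrow> ('a, 'c, 'l) module_scheme
     \<Rightarrow> ('a, 'b \<Rightarrow> 'c) module" where
  "Hom_module A M N =
     \<lparr>carrier = {h \<in> carrier M \<rightarrow>\<^sub>E carrier N.
         (\<forall>x\<in>carrier M. \<forall>y\<in>carrier M. h (x \<oplus>\<^bsub>M\<^esub> y) = h x \<oplus>\<^bsub>N\<^esub> h y) \<and>
         (\<forall>r\<in>carrier A. \<forall>x\<in>carrier M. h (r \<odot>\<^bsub>M\<^esub> x) = r \<odot>\<^bsub>N\<^esub> h x)},
      monoid.mult = undefined, one = undefined,
      zero = (\<lambda>x\<in>carrier M. \<zero>\<^bsub>N\<^esub>),
      add = (\<lambda>h k. \<lambda>x\<in>carrier M. h x \<oplus>\<^bsub>N\<^esub> k x),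
      smult = (\<lambda>r h. \<lambda>x\<in>carrier M. r \<odot>\<^bsub>N\<^esub> h x)\<rparr>"

text \<open>
  For a sequence of length \<open>s\<close>, the Koszul module in degree \<open>p\<close> is the \<open>p\<close>-th exterior power
  of \<open>A\<^sup>s\<close>, given as the free module on the \<open>p\<close>-element subsets of \<open>{0,\<dots>,s-1}\<close>; the subset
  \<open>{i\<^sub>1 < \<dots> < i\<^sub>p}\<close> stands for \<open>e\<^sub>i\<^sub>1 \<and> \<dots> \<and> e\<^sub>i\<^sub>p\<close>.
\<close>

definition koszul_basis :: "nat \<Rightarrow> nat \<Rightarrow> nat set set" where
  "koszul_basis s p = {T. T \<subseteq> {..<s} \<and> card T = p}"

definition koszul_module ::
  "('a, 'm) ring_scheme \<Rightarrow> 'a list \<Rightarrow> nat \<Rightarrow> ('a, nat set \<Rightarrow> 'a) module" where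
  "koszul_module A as p = free_module A (koszul_basis (length as) p)"

text \<open>
  The differential from degree \<open>p + 1\<close> to degree \<open>p\<close>. On a basis element \<open>e\<^sub>U\<close> it is
  the sum over \<open>i \<in> U\<close> of \<open>(-1)^#{j \<in> U. j < i} a\<^sub>i e\<^sub>U\<^sub>-\<^sub>{\<^sub>i\<^sub>}\<close>; below, this is
  written as the coefficient at \<open>T = U - {i}\<close>.
\<close>

definition koszul_diff ::
  "('a, 'm) ring_scheme \<Rightarrow> 'a list \<Rightarrow> nat \<Rightarrow> (nat set \<Rightarrow> 'a) \<Rightarrow> (nat set \<Rightarrow> 'a)" where
  "koszul_diff A as p f =
     (\<lambda>T\<in>koszul_basis (length as) p.
        \<Oplus>\<^bsub>A\<^esub>i\<in>{..<length as} - T.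
          ((\<ominus>\<^bsub>A\<^esub> \<one>\<^bsub>A\<^esub>) [^]\<^bsub>A\<^esub> card {j\<in>T. j < i})
            \<otimes>\<^bsub>A\<^esub> (as ! i \<otimes>\<^bsub>A\<^esub> f (insert i T)))"

definition koszul_cochains ::
  "('a, 'm) ring_scheme \<Rightarrow> 'a list \<Rightarrow> ('a, 'b, 'k) module_scheme \<Rightarrow> nat
     \<Rightarrow> ('a, (nat set \<Rightarrow> 'a) \<Rightarrow> 'b) module" where
  "koszul_cochains A as N i = Hom_module A (koszul_module A as i) N"

text \<open>The map from degree \<open>i\<close> to degree \<open>i + 1\<close> of the dual complex.\<close>

definition koszul_codiff ::
  "('a, 'm) ring_scheme \<Rightarrow> 'a list \<Rightarrow> nat
     \<Rightarrow> ((nat set \<Rightarrow> 'a) \<Rightarrow> 'b) \<Rightarrow> ((nat set \<Rightarrow> 'a) \<Rightarrow> 'b)" where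
  "koszul_codiff A as i h =
     (\<lambda>x\<in>carrier (koszul_module A as (Suc i)). h (koszul_diff A as i x))"

definition koszul_cocycles ::
  "('a, 'm) ring_scheme \<Rightarrow> 'a list \<Rightarrow> ('a, 'b, 'k) module_scheme \<Rightarrow> nat
     \<Rightarrow> ((nat set \<Rightarrow> 'a) \<Rightarrow> 'b) set" where
  "koszul_cocycles A as N i =
     {h \<in> carrier (koszul_cochains A as N i).
        koszul_codiff A as i h = \<zero>\<^bsub>koszul_cochains A as N (Suc i)\<^esub>}"

definition koszul_coboundaries ::
  "('a, 'm) ring_scheme \<Rightarrow> 'a list \<Rightarrow> ('a, 'b, 'k) module_scheme \<Rightarrow> nat
     \<Rightarrow> ((nat set \<Rightarrow> 'a) \<Rightarrow> 'b) set" where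
  "koszul_coboundaries A as N i =
     (case i of
        0 \<Rightarrow> {\<zero>\<^bsub>koszul_cochains A as N 0\<^esub>}
      | Suc j \<Rightarrow> koszul_codiff A as j ` carrier (koszul_cochains A as N j))"

text \<open>The Koszul cohomology as an abelian group, written multiplicatively.\<close>

definition koszul_cohomology ::
  "('a, 'm) ring_scheme \<Rightarrow> 'a list \<Rightarrow> ('a, 'b, 'k) module_scheme \<Rightarrow> nat
     \<Rightarrow> ((nat set \<Rightarrow> 'a) \<Rightarrow> 'b) set monoid" where
  "koszul_cohomology A as N i =
     (add_monoid (koszul_cochains A as N i)) \<lparr>carrier := koszul_cocycles A as N i\<rparr>
       Mod koszul_coboundaries A as N i"

text \<open>In \<^typ>\<open>enat\<close> the infimum of the empty set is \<open>\<infinity>\<close>.\<close>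

definition koszul_grade_seq ::
  "('a, 'm) ring_scheme \<Rightarrow> 'a list \<Rightarrow> ('a, 'b, 'k) module_scheme \<Rightarrow> enat" where
  "koszul_grade_seq A as N =
     Inf {enat i | i. carrier (koszul_cohomology A as N i) \<noteq> {\<one>\<^bsub>koszul_cohomology A as N i\<^esub>}}"

text \<open>
  The grade of a finitely generated ideal does not depend on the generating sequence, so the
  supremum may range over all finite generating sequences of all finitely generated ideals
  contained in \<open>J\<close>; no generators have to be chosen.
\<close>

definition koszul_grade ::
  "('a, 'm) ring_scheme \<Rightarrow> 'a set \<Rightarrow> ('a, 'b, 'k) module_scheme \<Rightarrow> enat" where
  "koszul_grade A J N =
     Sup {koszul_grade_seq A as N | I as.
        ideal I A \<and> I \<subseteq> J \<and> set as \<subseteq> carrier A \<and> I = Idl\<^bsub>A\<^esub> (set as)}"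

text \<open>
  Types cannot be quantified inside a formula, so the existence of a ring is asserted for rings
  whose carrier is a subset of one concrete infinite type. Only the type of the elements is
  prescribed by this; the carrier set and the ring operations are arbitrary.
\<close>

type_synonym witness_elem = "rat poly poly \<times> rat"

end

theory Submission
  imports Defs
begin

text \<open>
Let \<open>k\<close> be a field, \<open>R = k[x, y]\<close>, \<open>m = (x, y)\<close>, and let \<open>S\<close> be the trivial extension of \<open>R\<close> by
the \<open>R\<close>-module \<open>R/m = k\<close>: the pairs \<open>(f, a)\<close> with
\<open>(f, a) (g, b) = (f g, f(0,0) b + g(0,0) a)\<close>. The second summand has square zero, so \<open>S\<close> and \<open>R\<close>
have the same primes, with the same heights, and \<open>S\<close> is Noetherian because \<open>R\<close> is. But \<open>S\<close> has one
associated prime more, the maximal ideal over \<open>m\<close>, which is the annihilator of \<open>(0, 1)\<close>.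

Let \<open>P\<close> be the prime over \<open>(y)\<close> and \<open>Q\<close> the prime over \<open>(y, x - b)\<close>, where \<open>b \<noteq> 0\<close>. Their heights
are 1 and 2. Since \<open>(y)\<close> lies in \<open>m\<close>, the ideal \<open>P\<close> kills \<open>(0, 1)\<close> and has Koszul grade 0. The
point \<open>(b, 0)\<close> is not the origin, so the extra summand disappears in the localization at \<open>Q\<close>, which is
regular of dimension 2; as \<open>Q\<close> is maximal, its grade is 2. The grade jumps by 2 because the obstruction
that makes the grade of \<open>P\<close> vanish sits at another point of the line \<open>y = 0\<close>.

Each ingredient is obtained in an elementary way.

\<^item> Noetherianity comes from \<open>Hilbert_basis\<close>, used twice, and \<open>noetherian_S\<close>.

\<^item> The upper bounds on heights (\<open>prime_ideal_below_line\<close>, \<open>prime_chain_below_point\<close>) avoid Krull's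
  theorem: a nonzero prime of \<open>k[x][y]\<close> that meets \<open>k[x]\<close> only in 0 has no proper overprime of the same
  kind, by pseudo-division, and a prime inside \<open>(y, x - b)\<close> that contains a nonzero polynomial in \<open>x\<close>
  contains \<open>x - b\<close>.

\<^item> The upper bound on the grade of \<open>Q\<close> has to hold for every finite sequence \<open>a\<close> in \<open>Q\<close>. As \<open>Q\<close> is
  generated by two elements \<open>c\<close> and \<open>d\<close>, one can write \<open>a = c u + d v\<close>, and then \<open>u \<and> v\<close> is a Koszul
  2-cocycle of \<open>a\<close>. If the cohomology vanished in degrees 0, 1 and 2, successive primitives would
  produce an equation \<open>1 = c r + d q\<close> (\<open>koszul_not_exact_in_two_generated_ideal\<close>). For the lower bound
  it suffices that no nonzero element is killed by both \<open>c\<close> and \<open>d\<close>, and that their only syzygies are trivial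
  (\<open>koszul_grade_two_generated\<close>).
\<close>

section \<open>Ideals of a commutative ring type and the Hilbert basis theorem\<close>

hide_const (open) up_ring.monom up_ring.coeff

text \<open>
A commutative ring is a module over itself; its submodules are the ideals, and \<open>span\<close> is ideal generation.
\<close>

interpretation ideals: Modules.module "(*) :: 'a::comm_ring_1 \<Rightarrow> 'a \<Rightarrow> 'a"
  by unfold_locales (simp_all add: algebra_simps)

\<comment> \<open>For a ring acting on itself this rule is associativity read from right to left.\<close>
declare ideals.scale_scale [simp del]

definition finitely_generated :: "'a::comm_ring_1 set \<Rightarrow> bool" where
  "finitely_generated I \<longleftrightarrow> (\<exists>F. finite F \<and> I = ideals.span F)"

lemma span_image_sums:
  assumes "finite A" and "x \<in> ideals.span (a ` A)"
  obtains u where "x = (\<Sum>i\<in>A. u i * a i)"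
proof -
  have "ideals.span (a ` A) \<subseteq> range (\<lambda>u. \<Sum>i\<in>A. u i * a i)"
  proof (rule ideals.span_minimal)
    show "a ` A \<subseteq> range (\<lambda>u. \<Sum>i\<in>A. u i * a i)"
    proof safe
      fix j assume "j \<in> A"
      then show "a j \<in> range (\<lambda>u. \<Sum>i\<in>A. u i * a i)"
        using assms(1) by (intro range_eqI[of _ _ "\<lambda>i. if i = j then 1 else 0"])
          (simp add: if_distrib[of "\<lambda>r. r * _"] cong: if_cong)
    qed
    show "ideals.subspace (range (\<lambda>u. \<Sum>i\<in>A. u i * a i))"
    proof (rule ideals.subspaceI)
      show "0 \<in> range (\<lambda>u. \<Sum>i\<in>A. u i * a i)"
        by (intro range_eqI[of _ _ "\<lambda>i. 0"]) simp
    next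
      fix x y assume "x \<in> range (\<lambda>u. \<Sum>i\<in>A. u i * a i)" "y \<in> range (\<lambda>u. \<Sum>i\<in>A. u i * a i)"
      then obtain u v where "x = (\<Sum>i\<in>A. u i * a i)" "y = (\<Sum>i\<in>A. v i * a i)" by blast
      then show "x + y \<in> range (\<lambda>u. \<Sum>i\<in>A. u i * a i)"
        by (intro range_eqI[of _ _ "\<lambda>i. u i + v i"]) (simp add: sum.distrib distrib_right)
    next
      fix c x assume "x \<in> range (\<lambda>u. \<Sum>i\<in>A. u i * a i)"
      then obtain u where "x = (\<Sum>i\<in>A. u i * a i)" by blast
      then show "c * x \<in> range (\<lambda>u. \<Sum>i\<in>A. u i * a i)"
        by (intro range_eqI[of _ _ "\<lambda>i. c * u i"]) (simp add: sum_distrib_left mult.assoc)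
    qed
  qed
  then show ?thesis using assms(2) that by blast
qed

text \<open>
Elements of a span use only finitely many generators, so a finite set in the span of a sequence is
reached at a finite stage.
\<close>

lemma span_range_initial_segment:
  fixes a :: "nat \<Rightarrow> 'a::comm_ring_1"
  assumes "finite G" "G \<subseteq> ideals.span (range a)"
  shows "\<exists>m. G \<subseteq> ideals.span (a ` {..<m})"
  using assms
proof (induction G rule: finite_induct)
  case (insert g G)
  have mono: "ideals.span (a ` {..<m}) \<subseteq> ideals.span (a ` {..<n})" if "m \<le> n" for m n
    using that by (intro ideals.span_mono) auto
  from insert obtain m where m: "G \<subseteq> ideals.span (a ` {..<m})" by auto
  have "g \<in> ideals.span (range a)" using insert by auto
  then have "\<exists>k. g \<in> ideals.span (a ` {..<k})"
  proof (induction rule: ideals.span_induct_alt)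
    case base
    show ?case by (intro exI[of _ 0]) (rule ideals.span_zero)
  next
    case (step c x y)
    then obtain k j where k: "y \<in> ideals.span (a ` {..<k})" and j: "x = a j" by auto
    have "x \<in> ideals.span (a ` {..<max k (Suc j)})" unfolding j by (rule ideals.span_base) auto
    moreover have "y \<in> ideals.span (a ` {..<max k (Suc j)})" using k mono[of k "max k (Suc j)"] by auto
    ultimately show ?case by (blast intro: ideals.span_add ideals.span_scale)
  qed
  then obtain k where "g \<in> ideals.span (a ` {..<k})" by blast
  then have "insert g G \<subseteq> ideals.span (a ` {..<max m k})"
    using m mono[of m "max m k"] mono[of k "max m k"] by auto
  then show ?case by blast
qed auto

text \<open>
If \<open>J\<close> is not finitely generated, one can choose forever \<open>f n\<close> of least degree in \<open>J\<close> outside the ideal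
generated by the earlier choices. The leading coefficients generate a finitely generated ideal, so some
leading coefficient is a combination of the earlier ones. As the degrees never decrease, the leading term of that
\<open>f m\<close> can be cancelled with multiples of earlier choices, which contradicts the minimality of its degree.
\<close>

theorem Hilbert_basis:
  fixes J :: "'a::comm_ring_1 poly set"
  assumes noeth: "\<And>I :: 'a set. ideals.subspace I \<Longrightarrow> finitely_generated I"
    and J: "ideals.subspace J"
  shows "finitely_generated J"
proof (rule ccontr)
  assume nfg: "\<not> finitely_generated J"
  define g where "g F = arg_min degree (\<lambda>f. f \<in> J - ideals.span F)" for F
  have ex: "\<exists>f. f \<in> J - ideals.span F" if "finite F" "F \<subseteq> J" for F
    using ideals.span_minimal[OF that(2) J] nfg that(1) by (auto simp: finitely_generated_def)
  have gJ: "g F \<in> J" and g_notin: "g F \<notin> ideals.span F" if "finite F" "F \<subseteq> J" for F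
    using arg_min_natI[of "\<lambda>f. f \<in> J - ideals.span F", of _ degree] ex[OF that] by (auto simp: g_def)
  have g_min: "degree (g F) \<le> degree f" if "f \<in> J" "f \<notin> ideals.span F" for f F
    using arg_min_nat_le[of "\<lambda>f. f \<in> J - ideals.span F" f degree] that by (auto simp: g_def)
  define F where "F = rec_nat {} (\<lambda>_ F. insert (g F) F)"
  define f where "f n = g (F n)" for n
  have F_eq: "F n = f ` {..<n}" for n
    by (induction n) (auto simp: F_def f_def lessThan_Suc)
  have F_J: "F n \<subseteq> J" for n
  proof (induction n)
    case (Suc n)
    have "finite (F n)" by (simp add: F_eq)
    then show ?case using gJ[of "F n"] Suc by (simp add: F_def)
  qed (simp add: F_def)
  have fJ: "f n \<in> J" and f_notin: "f n \<notin> ideals.span (F n)" for n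
    using gJ[OF _ F_J, of n] g_notin[OF _ F_J, of n] F_eq[of n] by (simp_all add: f_def)
  have deg_mono: "degree (f i) \<le> degree (f m)" if "i < m" for i m
  proof -
    have "ideals.span (F i) \<subseteq> ideals.span (F m)"
      using that by (intro ideals.span_mono) (auto simp: F_eq)
    then show ?thesis using g_min[OF fJ, of m "F i"] f_notin[of m] by (auto simp: f_def)
  qed
  define a where "a n = lead_coeff (f n)" for n
  obtain G where G: "finite G" "ideals.span (range a) = ideals.span G"
    using noeth[OF ideals.subspace_span, of "range a"] by (auto simp: finitely_generated_def)
  then obtain m where "G \<subseteq> ideals.span (a ` {..<m})"
    using span_range_initial_segment[of G a] ideals.span_superset[of G] by auto
  then have "ideals.span (range a) \<subseteq> ideals.span (a ` {..<m})"
    using G(2) by (simp add: ideals.span_minimal)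
  moreover have "a m \<in> ideals.span (range a)" by (intro ideals.span_base) auto
  ultimately have "a m \<in> ideals.span (a ` {..<m})" by blast
  then obtain u where u: "a m = (\<Sum>i<m. u i * a i)"
    by (rule span_image_sums[rotated]) auto
  define s where "s = (\<Sum>i<m. monom (u i) (degree (f m) - degree (f i)) * f i)"
  define h where "h = f m - s"
  have s: "s \<in> ideals.span (F m)" unfolding s_def F_eq
    by (intro ideals.span_sum ideals.span_scale ideals.span_base) auto
  then have "s \<in> J" using ideals.span_minimal[OF F_J J] by blast
  then have hJ: "h \<in> J" unfolding h_def by (intro ideals.subspace_diff[OF J] fJ)
  have h_notin: "h \<notin> ideals.span (F m)"
    using ideals.span_add[OF s, of h] f_notin[of m] s by (auto simp: h_def)
  have coeff_h: "coeff h n = 0" if n: "n \<ge> degree (f m)" for n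
  proof -
    have "coeff (monom (u i) (degree (f m) - degree (f i)) * f i) n
        = (if n = degree (f m) then u i * a i else 0)" if "i < m" for i
      using deg_mono[OF that] n by (auto simp: coeff_monom_mult a_def coeff_eq_0)
    then have "coeff s n = (\<Sum>i<m. if n = degree (f m) then u i * a i else 0)"
      by (simp add: s_def coeff_sum)
    also have "\<dots> = coeff (f m) n"
      using n u by (cases "n = degree (f m)") (simp_all add: a_def coeff_eq_0)
    finally show ?thesis by (simp add: h_def)
  qed
  have "h \<noteq> 0" using h_notin ideals.span_zero by auto
  then have "degree h < degree (f m)"
    using coeff_h[of "degree h"] by (metis leading_coeff_0_iff not_le)
  moreover have "degree (f m) \<le> degree h" using g_min[OF hJ h_notin] by (simp add: f_def)
  ultimately show False by simp
qed

lemma field_ideal_finitely_generated: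
  fixes I :: "'a::field set"
  assumes I: "ideals.subspace I"
  shows "finitely_generated I"
proof (cases "I \<subseteq> {0}")
  case True
  then have "I = ideals.span {}" using ideals.subspace_0[OF I] by auto
  then show ?thesis unfolding finitely_generated_def by blast
next
  case False
  then obtain x where x: "x \<in> I" "x \<noteq> 0" by auto
  have "y \<in> I" for y using ideals.subspace_scale[OF I x(1), of "y / x"] x(2) by simp
  moreover have "y \<in> ideals.span {x}" for y
    using x(2) by (auto simp: ideals.span_singleton intro!: range_eqI[of _ _ "y / x"])
  ultimately have "I = ideals.span {x}" by blast
  then show ?thesis unfolding finitely_generated_def by blast
qed

section \<open>Primes of the polynomial ring in two variables\<close>

definition prime_ideal :: "'a::comm_ring_1 set \<Rightarrow> bool" where
  "prime_ideal p \<longleftrightarrow>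
     ideals.subspace p \<and> 1 \<notin> p \<and> (\<forall>a b. a * b \<in> p \<longrightarrow> a \<in> p \<or> b \<in> p)"

lemma prime_idealD:
  assumes "prime_ideal p"
  shows prime_ideal_subspace: "ideals.subspace p"
    and prime_ideal_one: "1 \<notin> p"
    and prime_ideal_mult: "a * b \<in> p \<Longrightarrow> a \<in> p \<or> b \<in> p"
  using assms by (auto simp: prime_ideal_def)

lemma prime_ideal_kernel:
  fixes \<phi> :: "'a::comm_ring_1 \<Rightarrow> 'b::idom"
  assumes "\<And>a b. \<phi> (a + b) = \<phi> a + \<phi> b" "\<And>a b. \<phi> (a * b) = \<phi> a * \<phi> b" "\<phi> 1 = 1"
  shows "prime_ideal {a. \<phi> a = 0}"
proof -
  have "\<phi> 0 = 0" using assms(1)[of 0 0] by (simp only: add_0_left add_cancel_right_right)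
  then show ?thesis using assms by (auto simp: prime_ideal_def ideals.subspace_def)
qed

text \<open>
An element of \<open>p\<close> can be divided by \<open>t\<close> without leaving \<open>p\<close>, and this forever; the measure \<open>\<mu>\<close>
forbids it for a nonzero element.
\<close>

lemma prime_ideal_below_principal:
  fixes t :: "'a::idom" and \<mu> :: "'a \<Rightarrow> nat"
  assumes p: "prime_ideal p" and t: "t \<notin> p" and dvd: "\<And>h. h \<in> p \<Longrightarrow> t dvd h"
    and \<mu>: "\<And>h. h \<noteq> 0 \<Longrightarrow> \<mu> h < \<mu> (t * h)"
  shows "p = {0}"
proof -
  have "h = 0" if "h \<in> p" for h
    using that
  proof (induction "\<mu> h" arbitrary: h rule: less_induct)
    case less
    obtain k where k: "h = t * k" using dvd[OF less.prems] by (auto elim: dvdE)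
    then have "k \<in> p" using prime_ideal_mult[OF p] less.prems t by blast
    then show ?case using less.hyps[of k] \<mu>[of k] k by auto
  qed
  then show ?thesis using ideals.subspace_0[OF prime_ideal_subspace[OF p]] by auto
qed

text \<open>
Over the fraction field \<open>K\<close> of the coefficient ring, such primes are nonzero primes of the principal
ideal domain \<open>K[y]\<close>, hence maximal. Pseudo-division expresses this without fractions: every
element of \<open>q\<close> becomes, after multiplication by a nonzero constant, a multiple of an element \<open>f\<close> of
least degree in \<open>q\<close>; an element of least degree in \<open>p\<close> shows that \<open>f \<in> p\<close>.
\<close>

lemma prime_ideals_with_zero_contraction:
  fixes p q :: "'a::idom poly set"
  assumes p: "prime_ideal p" and q: "prime_ideal q" and "p \<noteq> {0}" and "p \<subseteq> q"
    and contr: "\<And>r. [:r:] \<in> q \<Longrightarrow> r = 0"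
  shows "p = q"
proof -
  note ps = prime_ideal_subspace[OF p] and qs = prime_ideal_subspace[OF q]
  have least: "\<exists>f. f \<in> I \<and> f \<noteq> 0 \<and> (\<forall>g. g \<in> I \<longrightarrow> g \<noteq> 0 \<longrightarrow> degree f \<le> degree g)"
    if I: "ideals.subspace I" "I \<noteq> {0}" for I :: "'a poly set"
  proof -
    obtain x where "x \<in> I \<and> x \<noteq> 0" using I ideals.subspace_0[OF I(1)] by auto
    from ex_has_least_nat[of "\<lambda>f. f \<in> I \<and> f \<noteq> 0", OF this, of degree]
    show ?thesis by auto
  qed
  obtain h where h: "h \<in> p" "h \<noteq> 0" and h_min: "\<And>g. g \<in> p \<Longrightarrow> g \<noteq> 0 \<Longrightarrow> degree h \<le> degree g"
    using least[OF ps \<open>p \<noteq> {0}\<close>] by blast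
  have "q \<noteq> {0}" using h \<open>p \<subseteq> q\<close> by auto
  then obtain f where f: "f \<in> q" "f \<noteq> 0"
    and f_min: "\<And>g. g \<in> q \<Longrightarrow> g \<noteq> 0 \<Longrightarrow> degree f \<le> degree g"
    using least[OF qs] by blast
  \<comment> \<open>This makes the cofactor of \<open>f\<close> below smaller than \<open>h\<close>, so that it cannot lie in \<open>p\<close>.\<close>
  have "degree f \<noteq> 0"
    using f contr by (metis degree_eq_zeroE pCons_0_0)
  have multiple: "\<exists>a k. a \<noteq> 0 \<and> Polynomial.smult a g = f * k" if g: "g \<in> q" for g
  proof -
    obtain a k where ak: "a \<noteq> 0" "Polynomial.smult a g = f * k + pseudo_mod g f"
      using pseudo_mod(1)[OF f(2), of g] by blast
    have "[:a:] * g - k * f \<in> q"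
      by (intro ideals.subspace_diff[OF qs] ideals.subspace_scale[OF qs] g f)
    then have "pseudo_mod g f \<in> q" using ak by (simp add: mult.commute)
    then have "pseudo_mod g f = 0"
      using f_min pseudo_mod(2)[OF f(2), of g] by fastforce
    then show ?thesis using ak by auto
  qed
  have "f \<in> p"
  proof -
    obtain a k where ak: "a \<noteq> 0" "Polynomial.smult a h = f * k" using multiple h \<open>p \<subseteq> q\<close> by blast
    have "[:a:] * h \<in> p" by (intro ideals.subspace_scale[OF ps] h)
    then have "f * k \<in> p" using ak by simp
    moreover have "k \<noteq> 0" using ak h by auto
    moreover have "degree h = degree f + degree k"
      using ak \<open>k \<noteq> 0\<close> f(2) by (metis degree_mult_eq degree_smult_eq)
    ultimately show ?thesis
      using prime_ideal_mult[OF p] h_min[of k] \<open>degree f \<noteq> 0\<close> by fastforce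
  qed
  have "g \<in> p" if g: "g \<in> q" for g
  proof -
    obtain a k where ak: "a \<noteq> 0" "Polynomial.smult a g = f * k" using multiple g by blast
    have "k * f \<in> p" by (intro ideals.subspace_scale[OF ps] \<open>f \<in> p\<close>)
    then have "[:a:] * g \<in> p" using ak by (simp add: mult.commute)
    moreover have "[:a:] \<notin> p" using contr[of a] ak \<open>p \<subseteq> q\<close> by auto
    ultimately show ?thesis using prime_ideal_mult[OF p] by blast
  qed
  then show ?thesis using \<open>p \<subseteq> q\<close> by auto
qed

text \<open>
In \<open>k[x][y]\<close> the outer variable is \<open>y\<close>. The line is \<open>y = 0\<close>, and the points considered on it
are \<open>(x, y) = (b, 0)\<close>; thus \<open>[:[:-b, 1:]:]\<close> is \<open>x - b\<close> and \<open>[:0, 1:]\<close> is \<open>y\<close>.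
\<close>

definition line_ideal :: "'k::field poly poly set" where
  "line_ideal = {f. poly f 0 = 0}"

definition point_ideal :: "'k::field \<Rightarrow> 'k poly poly set" where
  "point_ideal b = {f. poly (poly f 0) b = 0}"

lemma prime_line_ideal: "prime_ideal line_ideal"
  unfolding line_ideal_def by (rule prime_ideal_kernel) auto

lemma prime_point_ideal: "prime_ideal (point_ideal b)"
  unfolding point_ideal_def by (rule prime_ideal_kernel) auto

lemma prime_zero: "prime_ideal {0 :: 'a::idom}"
  using prime_ideal_kernel[of "\<lambda>x :: 'a. x"] by simp

lemma point_ideal_generators:
  assumes "f \<in> point_ideal b"
  shows "\<exists>u v. f = [:[:-b, 1:]:] * u + [:0, 1:] * v"
proof -
  obtain c v where f: "f = pCons c v" by (cases f)
  then have "poly c b = 0" using assms by (simp add: point_ideal_def)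
  then obtain s where "c = [:-b, 1:] * s" by (auto simp: poly_eq_0_iff_dvd elim: dvdE)
  then have "f = [:[:-b, 1:]:] * [:s:] + [:0, 1:] * v" using f by simp
  then show ?thesis by blast
qed

lemma prime_ideal_below_line:
  assumes p: "prime_ideal p" and less: "p \<subset> (line_ideal :: 'k::field poly poly set)"
  shows "p = {0}"
proof (rule prime_ideal_below_principal[OF p])
  have dvd: "[:0, 1:] dvd f" if "f \<in> line_ideal" for f :: "'k poly poly"
    using that poly_eq_0_iff_dvd[of f 0] by (simp add: line_ideal_def)
  show "[:0, 1:] \<notin> p"
  proof
    assume "[:0, 1:] \<in> p"
    then have "line_ideal \<subseteq> p"
      using dvd ideals.subspace_scale[OF prime_ideal_subspace[OF p]]
      by (metis dvdE mult.commute subsetI)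
    then show False using less by blast
  qed
  show "[:0, 1:] dvd h" if "h \<in> p" for h using dvd that less by blast
  show "degree h < degree ([:0, 1:] * h)" if "h \<noteq> 0" for h :: "'k poly poly"
    using that by simp
qed

text \<open>
A polynomial \<open>r(x)\<close> in \<open>p\<close> vanishes at \<open>b\<close>. Splitting off factors \<open>x - b\<close> lowers its degree, and
since \<open>p\<close> is prime this must stop with \<open>x - b\<close> in \<open>p\<close>.
\<close>

lemma linear_in_prime_below_point:
  assumes p: "prime_ideal p" and le: "p \<subseteq> point_ideal b" and r: "[:r:] \<in> p" "r \<noteq> 0"
  shows "[:[:-b, 1:]:] \<in> p"
  using r
proof (induction "degree r" arbitrary: r rule: less_induct)
  case less
  have "poly r b = 0" using less.prems(1) le by (auto simp: point_ideal_def)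
  then obtain s where s: "r = [:-b, 1:] * s" by (auto simp: poly_eq_0_iff_dvd elim: dvdE)
  then have "s \<noteq> 0" using less.prems by auto
  then have "degree s < degree r" unfolding s by (subst degree_mult_eq) auto
  moreover have "[:r:] = [:[:-b, 1:]:] * [:s:]" by (simp add: s)
  ultimately show ?case
    using less prime_ideal_mult[OF p, of "[:[:-b, 1:]:]" "[:s:]"] \<open>s \<noteq> 0\<close> by auto
qed

text \<open>
Modulo \<open>x - b\<close>, the constant term in \<open>y\<close> of an element of \<open>p\<close> vanishes, so the element is a multiple
of \<open>y\<close>, and \<open>y\<close> can be cancelled because it is not in \<open>p\<close>.
\<close>

lemma prime_below_point_principal:
  assumes p: "prime_ideal p" and le: "p \<subseteq> point_ideal b"
    and x: "[:[:-b, 1:]:] \<in> p" and y: "[:0, 1:] \<notin> p" and "g \<in> p"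
  shows "[:[:-b, 1:]:] dvd g"
  using \<open>g \<in> p\<close>
proof (induction g)
  case (pCons a g)
  note ps = prime_ideal_subspace[OF p]
  have "poly a b = 0" using pCons.prems le by (auto simp: point_ideal_def)
  then obtain s where s: "a = [:-b, 1:] * s" by (auto simp: poly_eq_0_iff_dvd elim: dvdE)
  have "[:s:] * [:[:-b, 1:]:] \<in> p" by (intro ideals.subspace_scale[OF ps] x)
  then have "pCons a g - [:s:] * [:[:-b, 1:]:] \<in> p" by (intro ideals.subspace_diff[OF ps] pCons.prems)
  moreover have *: "pCons a g - [:s:] * [:[:-b, 1:]:] = [:0, 1:] * g" by (simp add: s)
  ultimately have "g \<in> p" using prime_ideal_mult[OF p, of "[:0, 1:]" g] y by auto
  then have "[:[:-b, 1:]:] dvd g" by (rule pCons.IH)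
  then have "[:[:-b, 1:]:] dvd [:0, 1:] * g + [:s:] * [:[:-b, 1:]:]"
    by (intro dvd_add dvd_mult dvd_triv_right)
  then show ?case using * by (metis diff_add_cancel)
qed simp

text \<open>
This bounds the height of a rational point by 2. Either \<open>q\<close> contains no nonzero polynomial in \<open>x\<close>, and
a nonzero \<open>p\<close> would equal \<open>q\<close>, or \<open>q\<close> contains \<open>x - b\<close>. It then misses \<open>y\<close>, so it is the principal
ideal \<open>(x - b)\<close>, and the primes below a principal prime are zero.
\<close>

lemma prime_chain_below_point:
  fixes p q :: "'k::field poly poly set"
  assumes p: "prime_ideal p" and q: "prime_ideal q" and pq: "p \<subset> q" and qb: "q \<subset> point_ideal b"
  shows "p = {0}"
proof (cases "\<exists>r. r \<noteq> 0 \<and> [:r:] \<in> q")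
  case False
  then show ?thesis using prime_ideals_with_zero_contraction[OF p q] pq by blast
next
  case True
  note qs = prime_ideal_subspace[OF q]
  have x: "[:[:-b, 1:]:] \<in> q" using linear_in_prime_below_point[OF q] qb True by blast
  have y: "[:0, 1:] \<notin> q"
  proof
    assume y: "[:0, 1:] \<in> q"
    have "f \<in> q" if f: "f \<in> point_ideal b" for f
    proof -
      obtain u v where "f = u * [:[:-b, 1:]:] + v * [:0, 1:]"
        using point_ideal_generators[OF f] by (metis mult.commute)
      then show ?thesis
        using ideals.subspace_add[OF qs ideals.subspace_scale[OF qs x] ideals.subspace_scale[OF qs y]]
        by metis
    qed
    then show False using qb by blast
  qed
  have dvd: "[:[:-b, 1:]:] dvd g" if "g \<in> q" for g
    using prime_below_point_principal[OF q _ x y that] qb by blast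
  have "[:[:-b, 1:]:] \<notin> p"
  proof
    assume "[:[:-b, 1:]:] \<in> p"
    then have "q \<subseteq> p"
      using dvd ideals.subspace_scale[OF prime_ideal_subspace[OF p]]
      by (metis dvdE mult.commute subsetI)
    then show False using pq by blast
  qed
  then show ?thesis
  proof (rule prime_ideal_below_principal[OF p])
    show "[:[:-b, 1:]:] dvd h" if "h \<in> p" for h using dvd that pq by blast
    \<comment> \<open>Multiplication by \<open>x - b\<close> leaves the degree in \<open>y\<close> unchanged, but raises the degree in \<open>x\<close> of
      the leading coefficient.\<close>
    show "degree (lead_coeff h) < degree (lead_coeff ([:[:-b, 1:]:] * h))" if "h \<noteq> 0" for h :: "'k poly poly"
    proof -
      have "lead_coeff ([:[:-b, 1:]:] * h) = [:-b, 1:] * lead_coeff h"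
        by (subst lead_coeff_mult) simp
      moreover have "degree ([:-b, 1:] * lead_coeff h) = Suc (degree (lead_coeff h))"
        using that by (subst degree_mult_eq) auto
      ultimately show ?thesis by (simp only: lessI)
    qed
  qed
qed

section \<open>Trivial extensions\<close>

text \<open>
This is the idealization of the module \<open>'k\<close>, on which \<open>'a\<close> acts through \<open>\<epsilon>\<close>.
\<close>

definition trivial_extension :: "('a::comm_ring_1 \<Rightarrow> 'k::comm_ring_1) \<Rightarrow> ('a \<times> 'k) ring" where
  "trivial_extension \<epsilon> =
     \<lparr>carrier = UNIV,
      monoid.mult = (\<lambda>x y. (fst x * fst y, \<epsilon> (fst x) * snd y + \<epsilon> (fst y) * snd x)),
      one = (1, 0), zero = (0, 0),
      add = (\<lambda>x y. (fst x + fst y, snd x + snd y))\<rparr>"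

locale type_ring_hom =
  fixes \<epsilon> :: "'a::comm_ring_1 \<Rightarrow> 'k::comm_ring_1"
  assumes hom_add: "\<epsilon> (x + y) = \<epsilon> x + \<epsilon> y"
    and hom_mult: "\<epsilon> (x * y) = \<epsilon> x * \<epsilon> y"
    and hom_one: "\<epsilon> 1 = 1"
begin

abbreviation S :: "('a \<times> 'k) ring" where "S \<equiv> trivial_extension \<epsilon>"

lemma S_simps [simp]:
  "carrier S = UNIV" "\<one>\<^bsub>S\<^esub> = (1, 0)" "\<zero>\<^bsub>S\<^esub> = (0, 0)"
  "x \<oplus>\<^bsub>S\<^esub> y = (fst x + fst y, snd x + snd y)"
  "x \<otimes>\<^bsub>S\<^esub> y = (fst x * fst y, \<epsilon> (fst x) * snd y + \<epsilon> (fst y) * snd x)"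
  by (simp_all add: trivial_extension_def)

lemma hom_zero: "\<epsilon> 0 = 0"
  using hom_add[of 0 0] by (simp only: add_0_left add_cancel_right_right)

lemma cring_S: "cring S"
proof (rule cringI)
  show "abelian_group S"
  proof (rule abelian_groupI)
    fix x assume "x \<in> carrier S"
    show "\<exists>y\<in>carrier S. y \<oplus>\<^bsub>S\<^esub> x = \<zero>\<^bsub>S\<^esub>"
      by (intro bexI[of _ "(- fst x, - snd x)"]) auto
  qed (auto simp: algebra_simps)
  show "comm_monoid S"
    by (rule comm_monoidI) (auto simp: hom_mult hom_one algebra_simps)
qed (auto simp: hom_add algebra_simps)

sublocale S: cring S
  by (rule cring_S)

lemma S_minus [simp]: "\<ominus>\<^bsub>S\<^esub> x = (- fst x, - snd x)"
  by (rule S.minus_equality) auto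

lemma ideal_S_lift: "(f, a) \<in> I \<Longrightarrow> ideal I S \<Longrightarrow> (r * f, \<epsilon> r * a) \<in> I"
  using ideal.I_l_closed[of I S "(f, a)" "(r, 0)"] by simp

text \<open>
An ideal \<open>J\<close> is generated by lifts of finitely many generators of its image in \<open>'a\<close> together with
generators of its part in the second summand, which is zero or everything since that summand is a
simple module.
\<close>

lemma noetherian_S:
  assumes noeth: "\<And>I :: 'a set. ideals.subspace I \<Longrightarrow> finitely_generated I"
    and units: "\<And>c :: 'k. c \<noteq> 0 \<Longrightarrow> c dvd 1" and surj: "surj \<epsilon>"
  shows "noetherian_ring S"
proof (rule S.noetherian_ringI)
  fix J assume J: "ideal J S"
  interpret J: ideal J S by (rule J)
  have "ideals.subspace (fst ` J)"
  proof (rule ideals.subspaceI)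
    show "0 \<in> fst ` J" using J.zero_closed by force
  next
    fix x y assume "x \<in> fst ` J" "y \<in> fst ` J"
    then obtain a b where "(x, a) \<in> J" "(y, b) \<in> J" by auto
    from J.a_closed[OF this] show "x + y \<in> fst ` J" by force
  next
    fix c x assume "x \<in> fst ` J"
    then show "c * x \<in> fst ` J" using ideal_S_lift[OF _ J] by force
  qed
  then obtain F where F: "finite F" "fst ` J = ideals.span F"
    using noeth[of "fst ` J"] unfolding finitely_generated_def by blast
  then have "\<forall>f\<in>F. \<exists>z. z \<in> J \<and> fst z = f"
    using ideals.span_base[of _ F] by (metis imageE)
  then obtain s where s: "s f \<in> J" "fst (s f) = f" if "f \<in> F" for f by metis
  define G where "G = s ` F \<union> ({(0, 1)} \<inter> J)"
  have G: "finite G" "G \<subseteq> J" using F s by (auto simp: G_def)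
  interpret G: ideal "Idl\<^bsub>S\<^esub> G" S by (rule S.genideal_ideal) simp
  have G_in: "g \<in> Idl\<^bsub>S\<^esub> G" if "g \<in> G" for g
    using S.genideal_self[of G] that by auto
  have lift: "\<exists>a. (f, a) \<in> Idl\<^bsub>S\<^esub> G" if "f \<in> ideals.span F" for f
    using that
  proof (induction rule: ideals.span_induct_alt)
    case base
    show ?case using G.zero_closed by auto
  next
    case (step c x y)
    then obtain a where a: "(y, a) \<in> Idl\<^bsub>S\<^esub> G" by auto
    have "s x \<in> Idl\<^bsub>S\<^esub> G" using step by (intro G_in) (auto simp: G_def)
    then have "(x, snd (s x)) \<in> Idl\<^bsub>S\<^esub> G" using s(2)[OF step(1)] by (metis prod.collapse)
    from G.a_closed[OF ideal_S_lift[OF this G.ideal_axioms, of c] a] show ?case by auto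
  qed
  have "z \<in> Idl\<^bsub>S\<^esub> G" if z: "z \<in> J" for z
  proof -
    obtain a where a: "(fst z, a) \<in> Idl\<^bsub>S\<^esub> G" using lift z F(2) by blast
    then have "(fst z, a) \<in> J" using S.genideal_minimal[OF J G(2)] by blast
    then have "z \<oplus>\<^bsub>S\<^esub> \<ominus>\<^bsub>S\<^esub> (fst z, a) \<in> J" by (intro J.a_closed J.a_inv_closed z)
    then have diff: "(0, snd z - a) \<in> J" by simp
    have "(0, snd z - a) \<in> Idl\<^bsub>S\<^esub> G"
    proof (cases "snd z - a = 0")
      case True
      then show ?thesis using G.zero_closed by simp
    next
      case False
      then obtain r where "\<epsilon> r * (snd z - a) = 1"
        using units surj by (metis dvdE mult.commute surjD)
      then have "(0, 1) \<in> J" using ideal_S_lift[OF diff J, of r] by simp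
      then have "(0, 1) \<in> Idl\<^bsub>S\<^esub> G" by (intro G_in) (simp add: G_def)
      moreover obtain r where "\<epsilon> r = snd z - a" using surj by (metis surjD)
      ultimately show ?thesis using ideal_S_lift[OF _ G.ideal_axioms, of 0 1 r] by simp
    qed
    from G.a_closed[OF a this] show ?thesis by simp
  qed
  then have "J = Idl\<^bsub>S\<^esub> G" using S.genideal_minimal[OF J G(2)] by blast
  then show "\<exists>A\<subseteq>carrier S. finite A \<and> J = Idl\<^bsub>S\<^esub> A" using G by auto
qed

abbreviation over :: "'a set \<Rightarrow> ('a \<times> 'k) set" where "over p \<equiv> fst -` p"

lemma primeideal_S:
  assumes p: "prime_ideal p"
  shows "primeideal (over p) S"
proof -
  note ps = prime_ideal_subspace[OF p]
  have "subgroup (over p) (add_monoid S)"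
  proof (rule subgroup.intro)
    fix x assume x: "x \<in> over p"
    have "inv\<^bsub>add_monoid S\<^esub> x = (- fst x, - snd x)"
      using S_minus[of x] by (simp add: a_inv_def)
    then show "inv\<^bsub>add_monoid S\<^esub> x \<in> over p"
      using x ideals.subspace_neg[OF ps] by simp
  qed (auto simp: ideals.subspace_add[OF ps] ideals.subspace_0[OF ps])
  then have ideal: "ideal (over p) S"
    using ideals.subspace_scale[OF ps]
    by (intro idealI S.ring_axioms) (auto simp: mult.commute)
  show ?thesis
  proof (rule primeidealI[OF ideal S.is_cring])
    have "(1, 0) \<notin> over p" using prime_ideal_one[OF p] by simp
    then show "carrier S \<noteq> over p" by (metis S_simps(1) UNIV_I)
    show "a \<in> over p \<or> b \<in> over p" if "a \<otimes>\<^bsub>S\<^esub> b \<in> over p" for a b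
      using prime_ideal_mult[OF p] that by simp
  qed
qed

text \<open>
Elements \<open>(0, a)\<close> square to zero, so they lie in every prime. Hence the primes of the extension
are the preimages of the primes of \<open>'a\<close>.
\<close>

lemma primeideal_S_cases:
  assumes P: "primeideal P S"
  obtains p where "prime_ideal p" "P = over p"
proof -
  interpret P: primeideal P S by (rule P)
  define p where "p = {f. (f, 0) \<in> P}"
  have nil: "(0, a) \<in> P" for a
    using P.I_prime[of "(0, a)" "(0, a)"] P.zero_closed by (simp add: hom_zero)
  have P_eq: "P = over p"
  proof safe
    fix f a assume "(f, a) \<in> P"
    from P.a_closed[OF this nil[of "- a"]] show "(f, a) \<in> over p" by (simp add: p_def)
  next
    fix f and a :: 'k assume "fst (f, a) \<in> p"
    then have "(f, 0) \<in> P" by (simp add: p_def)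
    from P.a_closed[OF this nil[of a]] show "(f, a) \<in> P" by simp
  qed
  have "ideals.subspace p"
  proof (rule ideals.subspaceI)
    show "0 \<in> p" using nil by (simp add: p_def)
    show "x + y \<in> p" if "x \<in> p" "y \<in> p" for x y
      using P.a_closed[of "(x, 0)" "(y, 0)"] that by (simp add: p_def)
    show "c * x \<in> p" if "x \<in> p" for c x
      using ideal_S_lift[of x 0 P c] P.ideal_axioms that by (simp add: p_def)
  qed
  moreover have "1 \<notin> p" using P.I_notcarr P.one_imp_carrier by (auto simp: p_def)
  moreover have "a \<in> p \<or> b \<in> p" if "a * b \<in> p" for a b
    using P.I_prime[of "(a, 0)" "(b, 0)"] that by (simp add: p_def)
  ultimately have "prime_ideal p" by (simp add: prime_ideal_def)
  then show ?thesis using P_eq that by blast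
qed

end

section \<open>Heights\<close>

lemma prime_height_eqI:
  assumes "\<forall>i\<le>n. primeideal (c i) A" "\<forall>i<n. c i \<subset> c (Suc i)" "c n = P"
    and max: "\<And>m c. \<forall>i\<le>m. primeideal (c i) A \<Longrightarrow> \<forall>i<m. c i \<subset> c (Suc i) \<Longrightarrow> c m = P \<Longrightarrow> m \<le> n"
  shows "prime_height A P = enat n"
  unfolding prime_height_def
proof (rule antisym)
  show "Sup {enat n |n. \<exists>c. (\<forall>i\<le>n. primeideal (c i) A) \<and> (\<forall>i<n. c i \<subset> c (Suc i)) \<and> c n = P} \<le> enat n"
    using max by (intro Sup_least) auto
  show "enat n \<le> Sup {enat n |n. \<exists>c. (\<forall>i\<le>n. primeideal (c i) A) \<and> (\<forall>i<n. c i \<subset> c (Suc i)) \<and> c n = P}"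
    using assms(1-3) by (intro Sup_upper) auto
qed

lemma fst_vimage_psubset_iff [simp]:
  "(fst -` p :: ('a \<times> 'b) set) \<subset> fst -` q \<longleftrightarrow> p \<subset> q"
proof -
  have "(fst -` p :: ('a \<times> 'b) set) \<subseteq> fst -` q \<longleftrightarrow> p \<subseteq> q" for p q :: "'a set"
  proof
    assume le: "(fst -` p :: ('a \<times> 'b) set) \<subseteq> fst -` q"
    show "p \<subseteq> q"
    proof
      fix x assume "x \<in> p"
      then have "(x, undefined) \<in> (fst -` p :: ('a \<times> 'b) set)" by simp
      then have "(x, undefined) \<in> (fst -` q :: ('a \<times> 'b) set)" using le by blast
      then show "x \<in> q" by simp
    qed
  qed auto
  then show ?thesis by (simp only: psubset_eq set_eq_subset)
qed

lemma line_subset_point: "line_ideal \<subset> point_ideal b"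
proof
  show "line_ideal \<subseteq> point_ideal b" by (auto simp: line_ideal_def point_ideal_def)
  have "[:[:-b, 1:]:] \<in> point_ideal b - line_ideal"
    by (simp add: line_ideal_def point_ideal_def)
  then show "line_ideal \<noteq> point_ideal b" by blast
qed

lemma prime_height_line:
  fixes \<epsilon> :: "'k::field poly poly \<Rightarrow> 'l::comm_ring_1"
  assumes \<epsilon>: "type_ring_hom \<epsilon>"
  shows "prime_height (trivial_extension \<epsilon>) (fst -` line_ideal) = 1"
proof -
  interpret type_ring_hom \<epsilon> by (rule \<epsilon>)
  have "prime_height S (fst -` line_ideal) = enat 1"
  proof (rule prime_height_eqI)
    let ?c = "\<lambda>i. fst -` (if i = 0 then {0} else line_ideal) :: ('k poly poly \<times> 'l) set"
    show "\<forall>i\<le>1. primeideal (?c i) S"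
      by (auto intro!: primeideal_S prime_zero prime_line_ideal)
    have "[:0, 1:] \<in> (line_ideal :: 'k poly poly set) - {0}" by (simp add: line_ideal_def)
    then have "{0} \<subset> (line_ideal :: 'k poly poly set)"
      using prime_ideal_subspace[OF prime_line_ideal] ideals.subspace_0 by blast
    then show "\<forall>i<1. ?c i \<subset> ?c (Suc i)" by simp
  next
    fix m and c :: "nat \<Rightarrow> ('k poly poly \<times> 'l) set"
    assume c: "\<forall>i\<le>m. primeideal (c i) S" "\<forall>i<m. c i \<subset> c (Suc i)" "c m = fst -` line_ideal"
    show "m \<le> 1"
    proof (rule ccontr)
      assume "\<not> m \<le> 1"
      define k where "k = m - 2"
      with \<open>\<not> m \<le> 1\<close> have m: "m = Suc (Suc k)" by simp
      obtain p where p: "prime_ideal p" "c k = fst -` p"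
        using c(1) m primeideal_S_cases[of "c k"] by (metis le_SucI order_refl)
      obtain q where q: "prime_ideal q" "c (Suc k) = fst -` q"
        using c(1) m primeideal_S_cases[of "c (Suc k)"] by (metis le_SucI order_refl)
      have less: "c k \<subset> c (Suc k)" "c (Suc k) \<subset> c m" using c(2) m by auto
      have "p \<subset> q" "q \<subset> line_ideal" using less by (simp_all add: p q c(3))
      then show False
        using prime_ideal_below_line[OF q(1)] ideals.subspace_0[OF prime_ideal_subspace[OF p(1)]]
        by auto
    qed
  qed simp
  then show ?thesis by (simp add: one_enat_def)
qed

lemma prime_height_point:
  fixes \<epsilon> :: "'k::field poly poly \<Rightarrow> 'l::comm_ring_1"
  assumes \<epsilon>: "type_ring_hom \<epsilon>"
  shows "prime_height (trivial_extension \<epsilon>) (fst -` point_ideal b) = 2"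
proof -
  interpret type_ring_hom \<epsilon> by (rule \<epsilon>)
  have "prime_height S (fst -` point_ideal b) = enat 2"
  proof (rule prime_height_eqI)
    let ?c = "\<lambda>i. fst -` (if i = 0 then {0} else if i = 1 then line_ideal else point_ideal b)
      :: ('k poly poly \<times> 'l) set"
    show "\<forall>i\<le>2::nat. primeideal (?c i) S"
      by (auto intro!: primeideal_S prime_zero prime_line_ideal prime_point_ideal)
    have "[:0, 1:] \<in> (line_ideal :: 'k poly poly set) - {0}" by (simp add: line_ideal_def)
    then have "{0} \<subset> (line_ideal :: 'k poly poly set)"
      using prime_ideal_subspace[OF prime_line_ideal] ideals.subspace_0 by blast
    moreover have "line_ideal \<subset> point_ideal b" by (rule line_subset_point)
    ultimately show "\<forall>i<2::nat. ?c i \<subset> ?c (Suc i)" by simp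
  next
    fix m and c :: "nat \<Rightarrow> ('k poly poly \<times> 'l) set"
    assume c: "\<forall>i\<le>m. primeideal (c i) S" "\<forall>i<m. c i \<subset> c (Suc i)" "c m = fst -` point_ideal b"
    show "m \<le> 2"
    proof (rule ccontr)
      assume "\<not> m \<le> 2"
      define k where "k = m - 3"
      with \<open>\<not> m \<le> 2\<close> have m: "m = Suc (Suc (Suc k))" by simp
      obtain p0 where p0: "prime_ideal p0" "c k = fst -` p0"
        using c(1) m primeideal_S_cases[of "c k"] by (metis le_SucI order_refl)
      obtain p where p: "prime_ideal p" "c (Suc k) = fst -` p"
        using c(1) m primeideal_S_cases[of "c (Suc k)"] by (metis le_SucI order_refl)
      obtain q where q: "prime_ideal q" "c (Suc (Suc k)) = fst -` q"
        using c(1) m primeideal_S_cases[of "c (Suc (Suc k))"] by (metis le_SucI order_refl)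
      have less: "c k \<subset> c (Suc k)" "c (Suc k) \<subset> c (Suc (Suc k))" "c (Suc (Suc k)) \<subset> c m"
        using c(2) m by auto
      have "p0 \<subset> p" "p \<subset> q" "q \<subset> point_ideal b" using less by (simp_all add: p0 p q c(3))
      then show False
        using prime_chain_below_point[OF p(1) q(1)]
          ideals.subspace_0[OF prime_ideal_subspace[OF p0(1)]] by auto
    qed
  qed simp
  then show ?thesis by (simp add: numeral_eq_enat)
qed

section \<open>Koszul cohomology in coordinates\<close>

text \<open>
A Koszul cochain with values in the ring is a functional on a free module, and it is determined by its values on
the standard basis. The lemmas up to \<open>koszul_exact_Suc_iff\<close> replace the complex of functionals by
the complex of these value functions.
\<close>

context cring
begin

definition std_basis :: "'i set \<Rightarrow> 'i \<Rightarrow> 'i \<Rightarrow> 'a" where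
  "std_basis X t = (\<lambda>u\<in>X. if u = t then \<one> else \<zero>)"

abbreviation functionals :: "'i set \<Rightarrow> (('i \<Rightarrow> 'a) \<Rightarrow> 'a) set" where
  "functionals X \<equiv> carrier (Hom_module R (free_module R X) (self_module R))"

definition functional_of :: "'i set \<Rightarrow> ('i \<Rightarrow> 'a) \<Rightarrow> ('i \<Rightarrow> 'a) \<Rightarrow> 'a" where
  "functional_of X \<phi> = (\<lambda>x\<in>X \<rightarrow>\<^sub>E carrier R. \<Oplus>t\<in>X. x t \<otimes> \<phi> t)"

lemma functionals_iff:
  "h \<in> functionals X \<longleftrightarrow>
     h \<in> (X \<rightarrow>\<^sub>E carrier R) \<rightarrow>\<^sub>E carrier R \<and>
     (\<forall>x\<in>X \<rightarrow>\<^sub>E carrier R. \<forall>y\<in>X \<rightarrow>\<^sub>E carrier R.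
        h (\<lambda>t\<in>X. x t \<oplus> y t) = h x \<oplus> h y) \<and>
     (\<forall>r\<in>carrier R. \<forall>x\<in>X \<rightarrow>\<^sub>E carrier R. h (\<lambda>t\<in>X. r \<otimes> x t) = r \<otimes> h x)"
  by (simp add: Hom_module_def free_module_def self_module_def)

lemma functional_closed: "h \<in> functionals X \<Longrightarrow> x \<in> X \<rightarrow>\<^sub>E carrier R \<Longrightarrow> h x \<in> carrier R"
  unfolding functionals_iff by blast

lemma functional_add:
  "h \<in> functionals X \<Longrightarrow> x \<in> X \<rightarrow>\<^sub>E carrier R \<Longrightarrow> y \<in> X \<rightarrow>\<^sub>E carrier R
    \<Longrightarrow> h (\<lambda>t\<in>X. x t \<oplus> y t) = h x \<oplus> h y"
  unfolding functionals_iff by blast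

lemma functional_scale:
  "h \<in> functionals X \<Longrightarrow> r \<in> carrier R \<Longrightarrow> x \<in> X \<rightarrow>\<^sub>E carrier R
    \<Longrightarrow> h (\<lambda>t\<in>X. r \<otimes> x t) = r \<otimes> h x"
  unfolding functionals_iff by blast

lemma std_basis_closed [simp]: "std_basis X t \<in> X \<rightarrow>\<^sub>E carrier R"
  by (auto simp: std_basis_def)

lemma functional_expand:
  assumes "finite X" and h: "h \<in> functionals X" and x: "x \<in> X \<rightarrow>\<^sub>E carrier R"
  shows "h x = (\<Oplus>t\<in>X. x t \<otimes> h (std_basis X t))"
proof -
  have xc: "x t \<in> carrier R" if "t \<in> X" for t using x that by auto
  have hc: "h (std_basis X t) \<in> carrier R" for t by (rule functional_closed[OF h]) simp
  \<comment> \<open>The truncation of \<open>x\<close> to the coordinates in \<open>Y\<close>, which is built up one coordinate at a time.\<close>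
  let ?x = "\<lambda>Y. \<lambda>t\<in>X. if t \<in> Y then x t else \<zero>"
  have "h (?x Y) = (\<Oplus>t\<in>Y. x t \<otimes> h (std_basis X t))" if "finite Y" "Y \<subseteq> X" for Y
    using that
  proof (induction Y rule: finite_induct)
    case empty
    have "?x {} = (\<lambda>t\<in>X. \<zero> \<otimes> x t)" by (rule restrict_ext) (simp add: xc)
    moreover have "h (\<lambda>t\<in>X. \<zero> \<otimes> x t) = \<zero>"
      using functional_scale[OF h zero_closed x] functional_closed[OF h x] by simp
    ultimately show ?case by (simp only: finsum_empty)
  next
    case (insert s Y)
    let ?s = "\<lambda>t\<in>X. x s \<otimes> std_basis X s t"
    have s: "?s \<in> X \<rightarrow>\<^sub>E carrier R" using insert.prems by (auto simp: xc std_basis_def)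
    have Y: "?x Y \<in> X \<rightarrow>\<^sub>E carrier R" by (auto simp: xc)
    have "?x (insert s Y) = (\<lambda>t\<in>X. ?s t \<oplus> ?x Y t)"
      using insert by (intro restrict_ext) (auto simp: std_basis_def xc)
    then have "h (?x (insert s Y)) = h ?s \<oplus> h (?x Y)"
      using functional_add[OF h s Y] by simp
    also have "h ?s = x s \<otimes> h (std_basis X s)"
      using insert by (intro functional_scale[OF h] xc) auto
    finally show ?case
      using insert by (simp add: finsum_insert xc hc subset_eq)
  qed
  note sum = this[OF \<open>finite X\<close> order_refl]
  have "?x X = x" using x by (auto simp: fun_eq_iff restrict_def PiE_def extensional_def)
  then show ?thesis using sum by simp
qed

lemma functional_eqI:
  assumes "finite X" "h \<in> functionals X" "k \<in> functionals X"
    and "\<And>t. t \<in> X \<Longrightarrow> h (std_basis X t) = k (std_basis X t)"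
  shows "h = k"
proof (rule extensionalityI)
  show "h \<in> extensional (X \<rightarrow>\<^sub>E carrier R)" "k \<in> extensional (X \<rightarrow>\<^sub>E carrier R)"
    using assms(2,3) unfolding functionals_iff by (auto simp: PiE_def)
  fix x assume x: "x \<in> X \<rightarrow>\<^sub>E carrier R"
  have "x t \<in> carrier R" if "t \<in> X" for t using x that by auto
  then show "h x = k x"
    using functional_closed[OF assms(3)] std_basis_closed assms(4)
    unfolding functional_expand[OF assms(1,2) x] functional_expand[OF assms(1,3) x]
    by (intro finsum_cong') auto
qed

lemma functional_of_functionals:
  assumes "finite X" and \<phi>: "\<And>t. t \<in> X \<Longrightarrow> \<phi> t \<in> carrier R"
  shows "functional_of X \<phi> \<in> functionals X"
  unfolding functionals_iff
proof (intro conjI ballI)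
  show "functional_of X \<phi> \<in> (X \<rightarrow>\<^sub>E carrier R) \<rightarrow>\<^sub>E carrier R"
    using \<phi> by (auto simp: functional_of_def intro!: finsum_closed)
next
  fix x y assume x: "x \<in> X \<rightarrow>\<^sub>E carrier R" and y: "y \<in> X \<rightarrow>\<^sub>E carrier R"
  have [simp]: "x t \<in> carrier R" "y t \<in> carrier R" if "t \<in> X" for t using x y that by auto
  have "(\<Oplus>t\<in>X. (x t \<oplus> y t) \<otimes> \<phi> t) = (\<Oplus>t\<in>X. x t \<otimes> \<phi> t \<oplus> y t \<otimes> \<phi> t)"
    using \<phi> by (intro finsum_cong') (auto simp: l_distr)
  also have "\<dots> = (\<Oplus>t\<in>X. x t \<otimes> \<phi> t) \<oplus> (\<Oplus>t\<in>X. y t \<otimes> \<phi> t)"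
    using \<phi> by (intro finsum_addf) auto
  moreover have "(\<Oplus>t\<in>X. (\<lambda>t\<in>X. x t \<oplus> y t) t \<otimes> \<phi> t) = (\<Oplus>t\<in>X. (x t \<oplus> y t) \<otimes> \<phi> t)"
    using \<phi> by (intro finsum_cong') auto
  ultimately show "functional_of X \<phi> (\<lambda>t\<in>X. x t \<oplus> y t) = functional_of X \<phi> x \<oplus> functional_of X \<phi> y"
    using x y by (auto simp: functional_of_def)
next
  fix r x assume r: "r \<in> carrier R" and x: "x \<in> X \<rightarrow>\<^sub>E carrier R"
  have [simp]: "x t \<in> carrier R" if "t \<in> X" for t using x that by auto
  have "(\<Oplus>t\<in>X. (\<lambda>t\<in>X. r \<otimes> x t) t \<otimes> \<phi> t) = (\<Oplus>t\<in>X. r \<otimes> (x t \<otimes> \<phi> t))"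
    using \<phi> r by (intro finsum_cong') (auto simp: m_assoc)
  also have "\<dots> = r \<otimes> (\<Oplus>t\<in>X. x t \<otimes> \<phi> t)"
    using \<phi> r assms(1) by (intro finsum_rdistr[symmetric]) auto
  finally show "functional_of X \<phi> (\<lambda>t\<in>X. r \<otimes> x t) = r \<otimes> functional_of X \<phi> x"
    using x r by (auto simp: functional_of_def)
qed

lemma functional_of_std_basis:
  assumes "finite X" and \<phi>: "\<And>t. t \<in> X \<Longrightarrow> \<phi> t \<in> carrier R" and "t \<in> X"
  shows "functional_of X \<phi> (std_basis X t) = \<phi> t"
proof -
  have "(\<Oplus>u\<in>X. std_basis X t u \<otimes> \<phi> u) = (\<Oplus>u\<in>X. if t = u then \<phi> u else \<zero>)"
    using \<phi> by (intro finsum_cong') (auto simp: std_basis_def)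
  also have "\<dots> = \<phi> t" using assms by (intro finsum_singleton) auto
  finally show ?thesis by (simp add: functional_of_def)
qed

lemma functionals_lincomb:
  assumes h: "h \<in> functionals X" and k: "k \<in> functionals X" and s: "s \<in> carrier R"
  shows "(\<lambda>x\<in>X \<rightarrow>\<^sub>E carrier R. h x \<oplus> s \<otimes> k x) \<in> functionals X"
proof -
  note [simp] = functional_closed[OF h] functional_closed[OF k] s
  show ?thesis
    unfolding functionals_iff
  proof (intro conjI ballI)
    show "(\<lambda>x\<in>X \<rightarrow>\<^sub>E carrier R. h x \<oplus> s \<otimes> k x) \<in> (X \<rightarrow>\<^sub>E carrier R) \<rightarrow>\<^sub>E carrier R"
      by auto
  next
    fix x y assume [simp]: "x \<in> X \<rightarrow>\<^sub>E carrier R" "y \<in> X \<rightarrow>\<^sub>E carrier R"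
    have [simp]: "x t \<in> carrier R" "y t \<in> carrier R" if "t \<in> X" for t
      by (rule PiE_mem[OF _ that], fact)+
    show "(\<lambda>x\<in>X \<rightarrow>\<^sub>E carrier R. h x \<oplus> s \<otimes> k x) (\<lambda>t\<in>X. x t \<oplus> y t) =
      (\<lambda>x\<in>X \<rightarrow>\<^sub>E carrier R. h x \<oplus> s \<otimes> k x) x \<oplus>
      (\<lambda>x\<in>X \<rightarrow>\<^sub>E carrier R. h x \<oplus> s \<otimes> k x) y"
      by (simp add: functional_add[OF h] functional_add[OF k] r_distr a_ac Pi_def)
  next
    fix r x assume [simp]: "r \<in> carrier R" "x \<in> X \<rightarrow>\<^sub>E carrier R"
    have [simp]: "x t \<in> carrier R" if "t \<in> X" for t by (rule PiE_mem[OF _ that]) fact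
    show "(\<lambda>x\<in>X \<rightarrow>\<^sub>E carrier R. h x \<oplus> s \<otimes> k x) (\<lambda>t\<in>X. r \<otimes> x t) =
      r \<otimes> (\<lambda>x\<in>X \<rightarrow>\<^sub>E carrier R. h x \<oplus> s \<otimes> k x) x"
      by (simp add: functional_scale[OF h] functional_scale[OF k] r_distr m_ac Pi_def)
  qed
qed

lemma finite_koszul_basis: "finite (koszul_basis n p)"
  unfolding koszul_basis_def by (rule finite_subset[of _ "Pow {..<n}"]) auto

lemma koszul_cochains_functionals:
  "carrier (koszul_cochains R as (self_module R) p) = functionals (koszul_basis (length as) p)"
  by (simp add: koszul_cochains_def koszul_module_def)

lemma koszul_module_carrier:
  "carrier (koszul_module R as p) = koszul_basis (length as) p \<rightarrow>\<^sub>E carrier R"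
  by (simp add: koszul_module_def free_module_def)

lemma koszul_basis_insert:
  "T \<in> koszul_basis n p \<Longrightarrow> i \<in> {..<n} - T \<Longrightarrow> insert i T \<in> koszul_basis n (Suc p)"
  by (auto simp: koszul_basis_def finite_subset)

lemma koszul_basis_remove:
  "U \<in> koszul_basis n (Suc p) \<Longrightarrow> i \<in> U \<Longrightarrow> U - {i} \<in> koszul_basis n p"
  by (auto simp: koszul_basis_def)

lemma koszul_diff_closed:
  assumes "set as \<subseteq> carrier R" and x: "x \<in> koszul_basis (length as) (Suc p) \<rightarrow>\<^sub>E carrier R"
  shows "koszul_diff R as p x \<in> koszul_basis (length as) p \<rightarrow>\<^sub>E carrier R"
proof -
  have [simp]: "as ! i \<in> carrier R" if "i < length as" for i using assms(1) that by auto
  have [simp]: "x (insert i T) \<in> carrier R" if "T \<in> koszul_basis (length as) p" "i \<in> {..<length as} - T" for i T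
    using x koszul_basis_insert[OF that] by auto
  show ?thesis unfolding koszul_diff_def
    by (intro restrict_PiE_iff[THEN iffD2] ballI finsum_closed funcsetI) auto
qed

lemma koszul_codiff_functional:
  assumes as: "set as \<subseteq> carrier R" and h: "h \<in> functionals (koszul_basis (length as) p)"
  shows "koszul_codiff R as p h \<in> functionals (koszul_basis (length as) (Suc p))"
proof -
  let ?X = "koszul_basis (length as) p" and ?Y = "koszul_basis (length as) (Suc p)"
  let ?I = "\<lambda>T. {..<length as} - T" and ?s = "\<lambda>T i. (\<ominus> \<one>) [^] card {j \<in> T. j < i}"
  have [simp]: "as ! i \<in> carrier R" if "i < length as" for i using as that by auto
  note closed = koszul_diff_closed[OF as]
  show ?thesis unfolding functionals_iff
  proof (intro conjI ballI)
    show "koszul_codiff R as p h \<in> (?Y \<rightarrow>\<^sub>E carrier R) \<rightarrow>\<^sub>E carrier R"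
      unfolding koszul_codiff_def koszul_module_carrier
      using functional_closed[OF h closed] by auto
  next
    fix x y assume x: "x \<in> ?Y \<rightarrow>\<^sub>E carrier R" and y: "y \<in> ?Y \<rightarrow>\<^sub>E carrier R"
    have [simp]: "x (insert i T) \<in> carrier R" "y (insert i T) \<in> carrier R"
      if "T \<in> ?X" "i < length as" "i \<notin> T" for i T
      using PiE_mem[OF x koszul_basis_insert] PiE_mem[OF y koszul_basis_insert] that by blast+
    have xy: "(\<lambda>t\<in>?Y. x t \<oplus> y t) \<in> ?Y \<rightarrow>\<^sub>E carrier R"
      unfolding restrict_PiE_iff by (intro ballI a_closed PiE_mem[OF x] PiE_mem[OF y])
    have "koszul_diff R as p (\<lambda>t\<in>?Y. x t \<oplus> y t)
        = (\<lambda>T\<in>?X. koszul_diff R as p x T \<oplus> koszul_diff R as p y T)"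
    proof (rule extensionalityI[of _ ?X])
      fix T assume T: "T \<in> ?X"
      have "(\<Oplus>i\<in>?I T. ?s T i \<otimes> (as ! i \<otimes> (\<lambda>t\<in>?Y. x t \<oplus> y t) (insert i T)))
        = (\<Oplus>i\<in>?I T. ?s T i \<otimes> (as ! i \<otimes> x (insert i T)) \<oplus> ?s T i \<otimes> (as ! i \<otimes> y (insert i T)))"
        using T koszul_basis_insert[OF T] by (intro finsum_cong') (auto simp: r_distr)
      also have "\<dots> = (\<Oplus>i\<in>?I T. ?s T i \<otimes> (as ! i \<otimes> x (insert i T)))
          \<oplus> (\<Oplus>i\<in>?I T. ?s T i \<otimes> (as ! i \<otimes> y (insert i T)))"
        using T by (intro finsum_addf) auto
      finally show "koszul_diff R as p (\<lambda>t\<in>?Y. x t \<oplus> y t) T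
          = (\<lambda>T\<in>?X. koszul_diff R as p x T \<oplus> koszul_diff R as p y T) T"
        using T by (simp only: koszul_diff_def restrict_apply' if_True)
    qed (simp_all add: koszul_diff_def)
    then show "koszul_codiff R as p h (\<lambda>t\<in>?Y. x t \<oplus> y t) =
        koszul_codiff R as p h x \<oplus> koszul_codiff R as p h y"
      using functional_add[OF h closed[OF x] closed[OF y]] x y xy
      by (simp add: koszul_codiff_def koszul_module_carrier)
  next
    fix r x assume r [simp]: "r \<in> carrier R" and x: "x \<in> ?Y \<rightarrow>\<^sub>E carrier R"
    have [simp]: "x (insert i T) \<in> carrier R" if "T \<in> ?X" "i < length as" "i \<notin> T" for i T
      using PiE_mem[OF x koszul_basis_insert] that by blast
    have rx: "(\<lambda>t\<in>?Y. r \<otimes> x t) \<in> ?Y \<rightarrow>\<^sub>E carrier R"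
      unfolding restrict_PiE_iff by (intro ballI m_closed r PiE_mem[OF x])
    have "koszul_diff R as p (\<lambda>t\<in>?Y. r \<otimes> x t) = (\<lambda>T\<in>?X. r \<otimes> koszul_diff R as p x T)"
    proof (rule extensionalityI[of _ ?X])
      fix T assume T: "T \<in> ?X"
      have "(\<Oplus>i\<in>?I T. ?s T i \<otimes> (as ! i \<otimes> (\<lambda>t\<in>?Y. r \<otimes> x t) (insert i T)))
        = (\<Oplus>i\<in>?I T. r \<otimes> (?s T i \<otimes> (as ! i \<otimes> x (insert i T))))"
        using T koszul_basis_insert[OF T] by (intro finsum_cong') (auto simp: m_ac)
      also have "\<dots> = r \<otimes> (\<Oplus>i\<in>?I T. ?s T i \<otimes> (as ! i \<otimes> x (insert i T)))"
        using T by (intro finsum_rdistr[symmetric]) auto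
      finally show "koszul_diff R as p (\<lambda>t\<in>?Y. r \<otimes> x t) T = (\<lambda>T\<in>?X. r \<otimes> koszul_diff R as p x T) T"
        using T by (simp only: koszul_diff_def restrict_apply' if_True)
    qed (simp_all add: koszul_diff_def)
    then show "koszul_codiff R as p h (\<lambda>t\<in>?Y. r \<otimes> x t) = r \<otimes> koszul_codiff R as p h x"
      using functional_scale[OF h r closed[OF x]] x rx
      by (simp add: koszul_codiff_def koszul_module_carrier)
  qed
qed

text \<open>
The dual differential in coordinates; equivalently, left multiplication by \<open>\<Sum>i. a\<^sub>i e\<^sub>i\<close> in the exterior algebra.
\<close>

definition koszul_delta :: "'a list \<Rightarrow> (nat set \<Rightarrow> 'a) \<Rightarrow> nat set \<Rightarrow> 'a" where
  "koszul_delta as \<phi> U =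
     (\<Oplus>i\<in>U. (\<ominus> \<one>) [^] card {j\<in>U - {i}. j < i} \<otimes> (as ! i \<otimes> \<phi> (U - {i})))"

text \<open>
The Koszul differential of the basis vector \<open>e\<^sub>U\<close> has nonzero coefficients only at the sets \<open>U - {i}\<close>
with \<open>i \<in> U\<close>, so expanding \<open>h\<close> over the basis leaves a sum over \<open>U\<close>.
\<close>

lemma koszul_codiff_std_basis:
  assumes as: "set as \<subseteq> carrier R" and h: "h \<in> functionals (koszul_basis (length as) p)"
    and U: "U \<in> koszul_basis (length as) (Suc p)"
  shows "koszul_codiff R as p h (std_basis (koszul_basis (length as) (Suc p)) U)
    = koszul_delta as (\<lambda>T. h (std_basis (koszul_basis (length as) p) T)) U"
proof -
  let ?n = "length as"
  let ?X = "koszul_basis ?n p" and ?Y = "koszul_basis ?n (Suc p)"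
  let ?e = "std_basis ?Y U" and ?\<phi> = "\<lambda>T. h (std_basis ?X T)"
  let ?sg = "\<lambda>T i. (\<ominus> \<one>) [^] card {j \<in> T. j < i}"
  let ?z = "koszul_diff R as p ?e"
  have [simp]: "as ! i \<in> carrier R" if "i < ?n" for i using as that by auto
  have [simp]: "?\<phi> T \<in> carrier R" for T by (rule functional_closed[OF h]) simp
  have U_n: "i < ?n" if "i \<in> U" for i using U that by (auto simp: koszul_basis_def)
  have inj: "inj_on (\<lambda>i. U - {i}) U" by (auto simp: inj_on_def)
  have coeff_zero: "?z T = \<zero>" if T: "T \<in> ?X - (\<lambda>i. U - {i}) ` U" for T
  proof -
    have ne: "insert i T \<noteq> U" if "i \<in> {..<?n} - T" for i
    proof
      assume "insert i T = U"
      then have "T = U - {i}" "i \<in> U" using that by auto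
      then show False using T by blast
    qed
    have "(\<Oplus>i\<in>{..<?n} - T. ?sg T i \<otimes> (as ! i \<otimes> ?e (insert i T))) = (\<Oplus>i\<in>{..<?n} - T. \<zero>)"
      using T ne by (intro finsum_cong') (auto simp: std_basis_def koszul_basis_insert)
    then show ?thesis using T by (simp add: koszul_diff_def finsum_zero)
  qed
  have coeff: "?z (U - {i}) = ?sg (U - {i}) i \<otimes> as ! i" if i: "i \<in> U" for i
  proof -
    let ?T = "U - {i}"
    have T: "?T \<in> ?X" by (rule koszul_basis_remove[OF U i])
    have "(\<Oplus>k\<in>{..<?n} - ?T. ?sg ?T k \<otimes> (as ! k \<otimes> ?e (insert k ?T)))
        = (\<Oplus>k\<in>{..<?n} - ?T. if i = k then ?sg ?T k \<otimes> as ! k else \<zero>)"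
    proof (rule finsum_cong')
      fix k assume k: "k \<in> {..<?n} - ?T"
      have "insert k ?T = U \<longleftrightarrow> i = k" using i k by auto
      then show "?sg ?T k \<otimes> (as ! k \<otimes> ?e (insert k ?T)) = (if i = k then ?sg ?T k \<otimes> as ! k else \<zero>)"
        using k koszul_basis_insert[OF T k] by (auto simp: std_basis_def)
    qed auto
    also have "\<dots> = ?sg ?T i \<otimes> as ! i"
      using i U_n by (intro finsum_singleton) auto
    finally show ?thesis using T by (simp add: koszul_diff_def)
  qed
  have closed: "?z \<in> ?X \<rightarrow>\<^sub>E carrier R" by (rule koszul_diff_closed[OF as std_basis_closed])
  have "koszul_codiff R as p h ?e = h ?z"
    by (simp add: koszul_codiff_def koszul_module_carrier)
  also have "\<dots> = (\<Oplus>T\<in>?X. ?z T \<otimes> ?\<phi> T)"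
    by (rule functional_expand[OF finite_koszul_basis h closed])
  also have "\<dots> = (\<Oplus>T\<in>(\<lambda>i. U - {i}) ` U. ?z T \<otimes> ?\<phi> T)"
  proof (rule add.finprod_mono_neutral_cong_right[OF finite_koszul_basis])
    show "(\<lambda>i. U - {i}) ` U \<subseteq> ?X" using koszul_basis_remove[OF U] by auto
    show "(\<lambda>T. ?z T \<otimes> ?\<phi> T) \<in> ?X \<rightarrow> carrier R"
      using closed by (auto simp: PiE_def Pi_def)
  qed (auto simp: coeff_zero)
  also have "\<dots> = (\<Oplus>i\<in>U. ?z (U - {i}) \<otimes> ?\<phi> (U - {i}))"
    using closed koszul_basis_remove[OF U]
    by (intro finsum_reindex inj) (auto simp: PiE_def Pi_def)
  also have "\<dots> = koszul_delta as ?\<phi> U"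
    unfolding koszul_delta_def
    by (intro finsum_cong') (auto simp: coeff m_assoc U_n)
  finally show ?thesis .
qed

lemma zero_functional:
  assumes "finite X"
  shows "(\<lambda>x\<in>X \<rightarrow>\<^sub>E carrier R. \<zero>) \<in> functionals X"
proof -
  have "functional_of X (\<lambda>_. \<zero>) = (\<lambda>x\<in>X \<rightarrow>\<^sub>E carrier R. \<zero>)"
    unfolding functional_of_def
  proof (rule restrict_ext)
    fix x assume x: "x \<in> X \<rightarrow>\<^sub>E carrier R"
    have "(\<Oplus>t\<in>X. x t \<otimes> \<zero>) = (\<Oplus>t\<in>X. \<zero>)"
      using PiE_mem[OF x] by (intro finsum_cong') auto
    then show "(\<Oplus>t\<in>X. x t \<otimes> \<zero>) = \<zero>" by (simp add: finsum_zero)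
  qed
  then show ?thesis using functional_of_functionals[OF assms, of "\<lambda>_. \<zero>"] by simp
qed

lemma koszul_cochains_zero:
  "\<zero>\<^bsub>koszul_cochains R as (self_module R) p\<^esub> = (\<lambda>x\<in>koszul_basis (length as) p \<rightarrow>\<^sub>E carrier R. \<zero>)"
  by (simp add: koszul_cochains_def Hom_module_def koszul_module_carrier self_module_def)

lemma koszul_cochains_add:
  "h \<oplus>\<^bsub>koszul_cochains R as (self_module R) p\<^esub> k
     = (\<lambda>x\<in>koszul_basis (length as) p \<rightarrow>\<^sub>E carrier R. h x \<oplus> k x)"
  by (simp add: koszul_cochains_def Hom_module_def koszul_module_carrier self_module_def)

lemma koszul_basis_nth_closed:
  assumes "set as \<subseteq> carrier R" "U \<in> koszul_basis (length as) p" "i \<in> U"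
  shows "as ! i \<in> carrier R"
proof -
  have "i < length as" using assms(2,3) by (auto simp: koszul_basis_def)
  then show ?thesis using assms(1) nth_mem by blast
qed

lemma koszul_delta_cong:
  assumes as: "set as \<subseteq> carrier R" and U: "U \<in> koszul_basis (length as) (Suc p)"
    and eq: "\<And>T. T \<in> koszul_basis (length as) p \<Longrightarrow> \<phi> T = \<psi> T"
    and \<psi>: "\<And>T. T \<in> koszul_basis (length as) p \<Longrightarrow> \<psi> T \<in> carrier R"
  shows "koszul_delta as \<phi> U = koszul_delta as \<psi> U"
proof -
  have "as ! i \<in> carrier R" if "i \<in> U" for i
    by (rule koszul_basis_nth_closed[OF as U that])
  then show ?thesis unfolding koszul_delta_def
    using koszul_basis_remove[OF U] eq \<psi> by (intro finsum_cong') auto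
qed

lemma koszul_cocycles_iff:
  assumes as: "set as \<subseteq> carrier R"
  shows "h \<in> koszul_cocycles R as (self_module R) p \<longleftrightarrow>
    h \<in> functionals (koszul_basis (length as) p) \<and>
    (\<forall>U\<in>koszul_basis (length as) (Suc p).
      koszul_delta as (\<lambda>T. h (std_basis (koszul_basis (length as) p) T)) U = \<zero>)"
proof -
  let ?Y = "koszul_basis (length as) (Suc p)"
  let ?Z = "\<lambda>x\<in>?Y \<rightarrow>\<^sub>E carrier R. \<zero>"
  have "koszul_codiff R as p h = ?Z \<longleftrightarrow>
      (\<forall>U\<in>?Y. koszul_delta as (\<lambda>T. h (std_basis (koszul_basis (length as) p) T)) U = \<zero>)"
    if h: "h \<in> functionals (koszul_basis (length as) p)"
  proof -
    have Z: "?Z (std_basis ?Y U) = \<zero>" for U by simp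
    have "koszul_codiff R as p h = ?Z \<longleftrightarrow>
        (\<forall>U\<in>?Y. koszul_codiff R as p h (std_basis ?Y U) = ?Z (std_basis ?Y U))"
      using functional_eqI[OF finite_koszul_basis koszul_codiff_functional[OF as h]
          zero_functional[OF finite_koszul_basis]] by metis
    then show ?thesis
      unfolding Z using koszul_codiff_std_basis[OF as h] by simp
  qed
  then show ?thesis
    unfolding koszul_cocycles_def koszul_cochains_functionals koszul_cochains_zero by blast
qed

lemma koszul_coboundaries_Suc_iff:
  assumes as: "set as \<subseteq> carrier R" and h: "h \<in> functionals (koszul_basis (length as) (Suc p))"
  shows "h \<in> koszul_coboundaries R as (self_module R) (Suc p) \<longleftrightarrow>
    (\<exists>\<psi>. (\<forall>T\<in>koszul_basis (length as) p. \<psi> T \<in> carrier R) \<and>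
      (\<forall>U\<in>koszul_basis (length as) (Suc p).
        h (std_basis (koszul_basis (length as) (Suc p)) U) = koszul_delta as \<psi> U))"
    (is "_ \<longleftrightarrow> ?R")
proof
  assume "h \<in> koszul_coboundaries R as (self_module R) (Suc p)"
  then obtain k where k: "k \<in> functionals (koszul_basis (length as) p)" "h = koszul_codiff R as p k"
    unfolding koszul_coboundaries_def koszul_cochains_functionals by auto
  then show ?R
    using functional_closed[OF k(1)] koszul_codiff_std_basis[OF as k(1)]
    by (intro exI[of _ "\<lambda>T. k (std_basis (koszul_basis (length as) p) T)"]) auto
next
  let ?X = "koszul_basis (length as) p" and ?Y = "koszul_basis (length as) (Suc p)"
  assume ?R
  then obtain \<psi> where \<psi>: "\<And>T. T \<in> ?X \<Longrightarrow> \<psi> T \<in> carrier R"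
    and eq: "\<And>U. U \<in> ?Y \<Longrightarrow> h (std_basis ?Y U) = koszul_delta as \<psi> U" by blast
  let ?k = "functional_of ?X \<psi>"
  have k: "?k \<in> functionals ?X" by (intro functional_of_functionals finite_koszul_basis \<psi>)
  have "h = koszul_codiff R as p ?k"
  proof (rule functional_eqI[OF finite_koszul_basis h koszul_codiff_functional[OF as k]])
    fix U assume U: "U \<in> ?Y"
    have "koszul_delta as \<psi> U = koszul_delta as (\<lambda>T. ?k (std_basis ?X T)) U"
      using functional_of_std_basis[of ?X \<psi>] \<psi>
      by (intro koszul_delta_cong[OF as U]) (auto simp: finite_koszul_basis)
    then show "h (std_basis ?Y U) = koszul_codiff R as p ?k (std_basis ?Y U)"
      by (simp add: eq[OF U] koszul_codiff_std_basis[OF as k U])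
  qed
  then show "h \<in> koszul_coboundaries R as (self_module R) (Suc p)"
    using k unfolding koszul_coboundaries_def koszul_cochains_functionals by auto
qed

lemma koszul_coboundaries_lincomb:
  assumes as: "set as \<subseteq> carrier R" and s: "s \<in> carrier R"
    and h: "h \<in> koszul_coboundaries R as (self_module R) p"
    and k: "k \<in> koszul_coboundaries R as (self_module R) p"
  shows "(\<lambda>x\<in>koszul_basis (length as) p \<rightarrow>\<^sub>E carrier R. h x \<oplus> s \<otimes> k x)
    \<in> koszul_coboundaries R as (self_module R) p"
proof (cases p)
  case 0
  then show ?thesis
    using h k s unfolding koszul_coboundaries_def koszul_cochains_zero
    by (auto intro: restrict_ext)
next
  case (Suc q)
  let ?X = "koszul_basis (length as) q"
  from h k Suc obtain h' k' where h': "h' \<in> functionals ?X" "h = koszul_codiff R as q h'"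
    and k': "k' \<in> functionals ?X" "k = koszul_codiff R as q k'"
    unfolding koszul_coboundaries_def koszul_cochains_functionals by auto
  let ?l = "\<lambda>x\<in>?X \<rightarrow>\<^sub>E carrier R. h' x \<oplus> s \<otimes> k' x"
  have eq: "koszul_codiff R as q ?l
      = (\<lambda>x\<in>koszul_basis (length as) p \<rightarrow>\<^sub>E carrier R. h x \<oplus> s \<otimes> k x)"
    unfolding koszul_codiff_def koszul_module_carrier Suc
    using koszul_diff_closed[OF as] h' k'
    by (intro restrict_ext) (simp add: koszul_codiff_def koszul_module_carrier)
  show ?thesis
    unfolding eq[symmetric] unfolding Suc koszul_coboundaries_def koszul_cochains_functionals nat.case
    by (intro imageI functionals_lincomb[OF h'(1) k'(1) s])
qed

lemma koszul_coboundaries_functional: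
  assumes as: "set as \<subseteq> carrier R"
    and h: "h \<in> koszul_coboundaries R as (self_module R) p"
  shows "h \<in> functionals (koszul_basis (length as) p)"
  using assms koszul_codiff_functional[OF as] zero_functional[OF finite_koszul_basis]
  unfolding koszul_coboundaries_def koszul_cochains_functionals koszul_cochains_zero
  by (auto split: nat.splits)

definition koszul_exact :: "'a list \<Rightarrow> nat \<Rightarrow> bool" where
  "koszul_exact as p \<longleftrightarrow>
     koszul_cocycles R as (self_module R) p \<subseteq> koszul_coboundaries R as (self_module R) p"

text \<open>
The elements of the cohomology are the cosets \<open>B + z\<close> of the coboundaries \<open>B\<close> by cocycles \<open>z\<close>. Such a
coset equals \<open>B\<close> exactly if \<open>z \<in> B\<close>; one direction uses that \<open>0 \<in> B\<close>, the other
that \<open>B\<close> is closed under sums and differences.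
\<close>

lemma koszul_cohomology_trivial_iff:
  assumes as: "set as \<subseteq> carrier R"
  shows "carrier (koszul_cohomology R as (self_module R) p)
      = {\<one>\<^bsub>koszul_cohomology R as (self_module R) p\<^esub>} \<longleftrightarrow> koszul_exact as p"
proof -
  define D where "D = koszul_basis (length as) p \<rightarrow>\<^sub>E carrier R"
  define Z where "Z = koszul_cocycles R as (self_module R) p"
  define B where "B = koszul_coboundaries R as (self_module R) p"
  define add where "add h k = (\<lambda>x\<in>D. h x \<oplus> k x)" for h k :: "(nat set \<Rightarrow> 'a) \<Rightarrow> 'a"
  have one: "\<one>\<^bsub>koszul_cohomology R as (self_module R) p\<^esub> = B"
    by (simp add: koszul_cohomology_def FactGroup_def B_def)
  have carr: "carrier (koszul_cohomology R as (self_module R) p) = (\<lambda>z. (\<lambda>b. add b z) ` B) ` Z"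
    by (auto simp: koszul_cohomology_def FactGroup_def RCOSETS_def r_coset_def B_def Z_def
        add_def[abs_def] koszul_cochains_add D_def)
  have comb: "(\<lambda>x\<in>D. h x \<oplus> s \<otimes> k x) \<in> B" if "h \<in> B" "k \<in> B" "s \<in> carrier R" for h k s
    using koszul_coboundaries_lincomb[OF as that(3)] that(1,2) by (simp add: B_def D_def)
  have closed: "h x \<in> carrier R" if "h \<in> B" "x \<in> D" for h x
    using functional_closed[OF koszul_coboundaries_functional[OF as]] that by (auto simp: B_def D_def)
  have ext: "(\<lambda>x\<in>D. h x) = h" if "h \<in> functionals (koszul_basis (length as) p)" for h
    using that unfolding functionals_iff D_def by (auto simp: PiE_def extensional_restrict)
  have zero_Z: "(\<lambda>x\<in>D. \<zero>) \<in> Z"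
  proof -
    have "koszul_delta as (\<lambda>T. \<zero>) U = \<zero>" if "U \<in> koszul_basis (length as) (Suc p)" for U
    proof -
      have "as ! i \<in> carrier R" if "i \<in> U" for i
        by (rule koszul_basis_nth_closed[OF as \<open>U \<in> _\<close> that])
      then have "koszul_delta as (\<lambda>T. \<zero>) U = (\<Oplus>i\<in>U. \<zero>)"
        unfolding koszul_delta_def by (intro finsum_cong') auto
      then show ?thesis by (simp add: finsum_zero)
    qed
    then show ?thesis
      unfolding Z_def D_def koszul_cocycles_iff[OF as]
      using zero_functional[OF finite_koszul_basis] by simp
  qed
  have zero_B: "(\<lambda>x\<in>D. \<zero>) \<in> B"
  proof (cases p)
    case (Suc q)
    have "(\<lambda>x\<in>D. \<zero>) = koszul_codiff R as q (\<lambda>x\<in>koszul_basis (length as) q \<rightarrow>\<^sub>E carrier R. \<zero>)"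
      unfolding D_def koszul_codiff_def koszul_module_carrier Suc
      using koszul_diff_closed[OF as] by (intro restrict_ext) simp
    then show ?thesis
      using zero_functional[OF finite_koszul_basis, of "length as" q]
      unfolding B_def Suc koszul_coboundaries_def koszul_cochains_functionals by auto
  qed (simp add: B_def D_def koszul_coboundaries_def koszul_cochains_zero)
  have "(\<lambda>z. (\<lambda>b. add b z) ` B) ` Z = {B} \<longleftrightarrow> Z \<subseteq> B"
  proof
    assume *: "(\<lambda>z. (\<lambda>b. add b z) ` B) ` Z = {B}"
    show "Z \<subseteq> B"
    proof
      fix z assume z: "z \<in> Z"
      have zf: "z \<in> functionals (koszul_basis (length as) p)"
        using z unfolding Z_def koszul_cocycles_iff[OF as] by blast
      have "add (\<lambda>x\<in>D. \<zero>) z = (\<lambda>x\<in>D. z x)"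
        unfolding add_def using functional_closed[OF zf]
        by (intro restrict_ext) (simp add: D_def)
      then have "add (\<lambda>x\<in>D. \<zero>) z = z" by (simp only: ext[OF zf])
      moreover have "(\<lambda>b. add b z) ` B \<in> {B}" unfolding *[symmetric] by (rule imageI[OF z])
      then have "add (\<lambda>x\<in>D. \<zero>) z \<in> B" using imageI[OF zero_B, of "\<lambda>b. add b z"] by simp
      ultimately show "z \<in> B" by simp
    qed
  next
    assume le: "Z \<subseteq> B"
    have "(\<lambda>b. add b z) ` B = B" if "z \<in> B" for z
    proof safe
      fix b assume "b \<in> B"
      then have "add b z = (\<lambda>x\<in>D. b x \<oplus> \<one> \<otimes> z x)"
        unfolding add_def by (intro restrict_ext) (simp add: closed \<open>z \<in> B\<close>)
      then show "add b z \<in> B" using comb[OF \<open>b \<in> B\<close> that, of \<one>] by simp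
    next
      fix b assume b: "b \<in> B"
      let ?c = "\<lambda>x\<in>D. b x \<oplus> \<ominus> \<one> \<otimes> z x"
      have "add ?c z = (\<lambda>x\<in>D. b x)"
        unfolding add_def using closed[OF b] closed[OF that]
        by (intro restrict_ext) (simp add: l_minus a_assoc l_neg)
      then have "b = add ?c z"
        using ext[OF koszul_coboundaries_functional[OF as]] b by (simp add: B_def)
      moreover have "?c \<in> B" by (intro comb b that) simp
      ultimately show "b \<in> (\<lambda>b. add b z) ` B" by (rule image_eqI)
    qed
    then have "(\<lambda>z. (\<lambda>b. add b z) ` B) ` Z = (\<lambda>_. B) ` Z"
      using le by (intro image_cong refl) (simp only: subset_eq)
    also have "\<dots> = {B}" using zero_Z by (simp add: image_constant[of "\<lambda>x\<in>D. \<zero>"])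
    finally show "(\<lambda>z. (\<lambda>b. add b z) ` B) ` Z = {B}" .
  qed
  then show ?thesis unfolding one carr koszul_exact_def Z_def B_def by simp
qed

lemma koszul_grade_seq_eq:
  assumes "set as \<subseteq> carrier R"
  shows "koszul_grade_seq R as (self_module R) = Inf {enat i |i. \<not> koszul_exact as i}"
  unfolding koszul_grade_seq_def koszul_cohomology_trivial_iff[OF assms] ..

lemma koszul_basis_0: "koszul_basis n 0 = {{}}"
  by (auto simp: koszul_basis_def finite_subset)

lemma koszul_exact_0_iff:
  assumes as: "set as \<subseteq> carrier R"
  shows "koszul_exact as 0 \<longleftrightarrow>
    (\<forall>\<phi>. \<phi> {} \<in> carrier R \<longrightarrow> (\<forall>U\<in>koszul_basis (length as) 1. koszul_delta as \<phi> U = \<zero>)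
      \<longrightarrow> \<phi> {} = \<zero>)"
proof -
  let ?X = "koszul_basis (length as) 0"
  have fin: "finite ?X" by (rule finite_koszul_basis)
  have coboundary: "h \<in> koszul_coboundaries R as (self_module R) 0 \<longleftrightarrow> h (std_basis ?X {}) = \<zero>"
    if h: "h \<in> functionals ?X" for h
  proof
    assume "h (std_basis ?X {}) = \<zero>"
    then have "h = (\<lambda>x\<in>?X \<rightarrow>\<^sub>E carrier R. \<zero>)"
      by (intro functional_eqI[OF fin h zero_functional[OF fin]]) (simp add: koszul_basis_0)
    then show "h \<in> koszul_coboundaries R as (self_module R) 0"
      by (simp add: koszul_coboundaries_def koszul_cochains_zero)
  qed (simp add: koszul_coboundaries_def koszul_cochains_zero)
  show ?thesis
  proof (intro iffI allI impI)
    fix \<phi> :: "nat set \<Rightarrow> 'a"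
    assume exact: "koszul_exact as 0" and \<phi>: "\<phi> {} \<in> carrier R"
      and cocycle: "\<forall>U\<in>koszul_basis (length as) 1. koszul_delta as \<phi> U = \<zero>"
    let ?h = "functional_of ?X \<phi>"
    have \<phi>': "\<phi> T \<in> carrier R" if "T \<in> ?X" for T using that \<phi> by (simp add: koszul_basis_0)
    have h: "?h \<in> functionals ?X" by (intro functional_of_functionals fin \<phi>')
    have val: "?h (std_basis ?X T) = \<phi> T" if "T \<in> ?X" for T
      by (intro functional_of_std_basis fin \<phi>' that)
    have "koszul_delta as (\<lambda>T. ?h (std_basis ?X T)) U = koszul_delta as \<phi> U"
      if "U \<in> koszul_basis (length as) (Suc 0)" for U
      by (rule koszul_delta_cong[OF as that val \<phi>'])
    then have "?h \<in> koszul_cocycles R as (self_module R) 0"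
      unfolding koszul_cocycles_iff[OF as] using h cocycle by simp
    then show "\<phi> {} = \<zero>"
      using exact coboundary[OF h] val[of "{}"] unfolding koszul_exact_def
      by (auto simp: koszul_basis_0)
  next
    assume *: "\<forall>\<phi>. \<phi> {} \<in> carrier R \<longrightarrow> (\<forall>U\<in>koszul_basis (length as) 1. koszul_delta as \<phi> U = \<zero>)
      \<longrightarrow> \<phi> {} = \<zero>"
    show "koszul_exact as 0" unfolding koszul_exact_def
    proof
      fix h assume "h \<in> koszul_cocycles R as (self_module R) 0"
      then have h: "h \<in> functionals ?X"
        and cocycle: "\<forall>U\<in>koszul_basis (length as) 1. koszul_delta as (\<lambda>T. h (std_basis ?X T)) U = \<zero>"
        unfolding koszul_cocycles_iff[OF as] by auto
      show "h \<in> koszul_coboundaries R as (self_module R) 0"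
        unfolding coboundary[OF h]
        using *[rule_format, of "\<lambda>T. h (std_basis ?X T)"] cocycle functional_closed[OF h] by auto
    qed
  qed
qed

lemma koszul_exact_Suc_iff:
  assumes as: "set as \<subseteq> carrier R"
  shows "koszul_exact as (Suc p) \<longleftrightarrow>
    (\<forall>\<phi>. (\<forall>T\<in>koszul_basis (length as) (Suc p). \<phi> T \<in> carrier R) \<longrightarrow>
      (\<forall>U\<in>koszul_basis (length as) (Suc (Suc p)). koszul_delta as \<phi> U = \<zero>) \<longrightarrow>
      (\<exists>\<psi>. (\<forall>T\<in>koszul_basis (length as) p. \<psi> T \<in> carrier R) \<and>
        (\<forall>U\<in>koszul_basis (length as) (Suc p). \<phi> U = koszul_delta as \<psi> U)))"
    (is "_ \<longleftrightarrow> ?R")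
proof
  let ?X = "koszul_basis (length as) (Suc p)"
  have fin: "finite ?X" by (rule finite_koszul_basis)
  {
    assume exact: "koszul_exact as (Suc p)"
    show ?R
    proof (intro allI impI)
      fix \<phi> :: "nat set \<Rightarrow> 'a"
      assume \<phi>: "\<forall>T\<in>?X. \<phi> T \<in> carrier R"
        and cocycle: "\<forall>U\<in>koszul_basis (length as) (Suc (Suc p)). koszul_delta as \<phi> U = \<zero>"
      let ?h = "functional_of ?X \<phi>"
      have \<phi>': "\<phi> T \<in> carrier R" if "T \<in> ?X" for T using that \<phi> by blast
      have h: "?h \<in> functionals ?X" by (intro functional_of_functionals fin \<phi>')
      have val: "?h (std_basis ?X T) = \<phi> T" if "T \<in> ?X" for T
        by (intro functional_of_std_basis fin \<phi>' that)
      have "koszul_delta as (\<lambda>T. ?h (std_basis ?X T)) U = koszul_delta as \<phi> U"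
        if "U \<in> koszul_basis (length as) (Suc (Suc p))" for U
        by (rule koszul_delta_cong[OF as that val \<phi>'])
      then have "?h \<in> koszul_cocycles R as (self_module R) (Suc p)"
        unfolding koszul_cocycles_iff[OF as] using h cocycle by simp
      then have "?h \<in> koszul_coboundaries R as (self_module R) (Suc p)"
        using exact unfolding koszul_exact_def by blast
      then show "\<exists>\<psi>. (\<forall>T\<in>koszul_basis (length as) p. \<psi> T \<in> carrier R) \<and>
          (\<forall>U\<in>?X. \<phi> U = koszul_delta as \<psi> U)"
        unfolding koszul_coboundaries_Suc_iff[OF as h] using val by auto
    qed
  next
    assume *: ?R
    show "koszul_exact as (Suc p)" unfolding koszul_exact_def
    proof
      fix h assume "h \<in> koszul_cocycles R as (self_module R) (Suc p)"
      then have h: "h \<in> functionals ?X"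
        and cocycle: "\<forall>U\<in>koszul_basis (length as) (Suc (Suc p)).
          koszul_delta as (\<lambda>T. h (std_basis ?X T)) U = \<zero>"
        unfolding koszul_cocycles_iff[OF as] by auto
      show "h \<in> koszul_coboundaries R as (self_module R) (Suc p)"
        unfolding koszul_coboundaries_Suc_iff[OF as h]
        using *[rule_format, of "\<lambda>T. h (std_basis ?X T)"] cocycle functional_closed[OF h] by auto
    qed
  }
qed

section \<open>Koszul cohomology in degrees 0, 1 and 2\<close>

lemma koszul_basis_1: "koszul_basis n (Suc 0) = {{i} |i. i < n}"
  by (auto simp: koszul_basis_def card_Suc_eq)

lemma koszul_basis_2: "koszul_basis n (Suc (Suc 0)) = {{i, j} |i j. i < j \<and> j < n}"
proof (intro subset_antisym subsetI)
  fix T assume "T \<in> koszul_basis n (Suc (Suc 0))"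
  then obtain i j where T: "T = {i, j}" "i \<noteq> j" "i < n" "j < n"
    by (auto simp: koszul_basis_def card_Suc_eq)
  show "T \<in> {{i, j} |i j. i < j \<and> j < n}"
  proof (cases "i < j")
    case True
    then show ?thesis using T by blast
  next
    case False
    then have "T = {j, i} \<and> j < i \<and> i < n" using T by auto
    then show ?thesis by blast
  qed
qed (auto simp: koszul_basis_def)

lemma koszul_basis_3:
  assumes "U \<in> koszul_basis n (Suc (Suc (Suc 0)))"
  obtains i j k where "U = {i, j, k}" "i < j" "j < k" "k < n"
proof -
  from assms have U: "finite U" "card U = 3" "U \<subseteq> {..<n}"
    by (auto simp: koszul_basis_def intro: finite_subset)
  then have ne: "U \<noteq> {}" by auto
  define i where "i = Min U"
  have i: "i \<in> U" using U ne by (simp add: i_def)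
  have "U - {i} \<in> koszul_basis n (Suc (Suc 0))"
    by (rule koszul_basis_remove[OF assms i])
  then obtain j k where jk: "U - {i} = {j, k}" "j < k" "k < n"
    unfolding koszul_basis_2 by blast
  then have "j \<in> U" "j \<noteq> i" by auto
  then have "i < j" using Min_le[OF U(1), of j] by (simp add: i_def)
  moreover have "U = {i, j, k}" using jk i by auto
  ultimately show ?thesis using that jk by blast
qed

lemma koszul_delta_singleton:
  assumes "as ! i \<in> carrier R" "\<phi> {} \<in> carrier R"
  shows "koszul_delta as \<phi> {i} = as ! i \<otimes> \<phi> {}"
proof -
  have "{i} - {i} = {}" "{j \<in> {}. j < i} = {}" by auto
  then show ?thesis
    using assms unfolding koszul_delta_def by (subst finsum_insert) (auto simp: finsum_empty)
qed

lemma koszul_delta_pair: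
  assumes ij: "i < j" and as: "as ! i \<in> carrier R" "as ! j \<in> carrier R"
    and \<phi>: "\<phi> {i} \<in> carrier R" "\<phi> {j} \<in> carrier R"
  shows "koszul_delta as \<phi> {i, j} = as ! i \<otimes> \<phi> {j} \<ominus> as ! j \<otimes> \<phi> {i}"
proof -
  have sets: "{i, j} - {i} = {j}" "{i, j} - {j} = {i}"
    "{l \<in> {j}. l < i} = {}" "{l \<in> {i}. l < j} = {i}"
    using ij by auto
  define t where "t l = (\<ominus> \<one>) [^] card {m \<in> {i, j} - {l}. m < l} \<otimes> (as ! l \<otimes> \<phi> ({i, j} - {l}))" for l
  have t: "t i = as ! i \<otimes> \<phi> {j}" "t j = \<ominus> (as ! j \<otimes> \<phi> {i})"
    unfolding t_def sets using as \<phi> by (simp_all add: l_minus)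
  have "koszul_delta as \<phi> {i, j} = t i \<oplus> t j"
    unfolding koszul_delta_def t_def[symmetric]
    using ij as \<phi> by (subst finsum_insert) (auto simp: t finsum_insert finsum_empty)
  then show ?thesis by (simp add: t minus_eq)
qed

lemma koszul_delta_triple:
  assumes ijk: "i < j" "j < k"
    and as: "as ! i \<in> carrier R" "as ! j \<in> carrier R" "as ! k \<in> carrier R"
    and \<phi>: "\<phi> {j, k} \<in> carrier R" "\<phi> {i, k} \<in> carrier R" "\<phi> {i, j} \<in> carrier R"
  shows "koszul_delta as \<phi> {i, j, k}
    = as ! i \<otimes> \<phi> {j, k} \<ominus> as ! j \<otimes> \<phi> {i, k} \<oplus> as ! k \<otimes> \<phi> {i, j}"
proof -
  have sets: "{i, j, k} - {i} = {j, k}" "{i, j, k} - {j} = {i, k}" "{i, j, k} - {k} = {i, j}"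
    "{l \<in> {j, k}. l < i} = {}" "{l \<in> {i, k}. l < j} = {i}" "{l \<in> {i, j}. l < k} = {i, j}"
    using ijk by auto
  have card: "card {i, j} = 2" using ijk by simp
  have sq: "(\<ominus> \<one>) [^] (2 :: nat) = \<one>" by (simp add: numeral_2_eq_2 l_minus r_minus)
  define t where "t l = (\<ominus> \<one>) [^] card {m \<in> {i, j, k} - {l}. m < l}
    \<otimes> (as ! l \<otimes> \<phi> ({i, j, k} - {l}))" for l
  have t: "t i = as ! i \<otimes> \<phi> {j, k}" "t j = \<ominus> (as ! j \<otimes> \<phi> {i, k})" "t k = as ! k \<otimes> \<phi> {i, j}"
    unfolding t_def sets card sq using as \<phi> by (simp_all add: l_minus)
  have "koszul_delta as \<phi> {i, j, k} = t i \<oplus> (t j \<oplus> t k)"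
    unfolding koszul_delta_def t_def[symmetric]
    using ijk as \<phi> by (subst finsum_insert) (auto simp: t finsum_insert finsum_empty)
  then show ?thesis using as \<phi> by (simp add: t minus_eq a_assoc)
qed

lemma koszul_exact_0_iff_annihilator:
  assumes as: "set as \<subseteq> carrier R"
  shows "koszul_exact as 0 \<longleftrightarrow>
    (\<forall>f\<in>carrier R. (\<forall>i<length as. as ! i \<otimes> f = \<zero>) \<longrightarrow> f = \<zero>)"
proof -
  have a: "as ! i \<in> carrier R" if "i < length as" for i using as that nth_mem by blast
  have delta: "(\<forall>U\<in>koszul_basis (length as) 1. koszul_delta as \<phi> U = \<zero>)
      \<longleftrightarrow> (\<forall>i<length as. as ! i \<otimes> \<phi> {} = \<zero>)" if "\<phi> {} \<in> carrier R" for \<phi>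
    using koszul_delta_singleton[where \<phi> = \<phi>, OF a that] by (auto simp: koszul_basis_1)
  show ?thesis
    unfolding koszul_exact_0_iff[OF as]
  proof (intro iffI ballI allI impI)
    fix f assume *: "\<forall>\<phi>. \<phi> {} \<in> carrier R \<longrightarrow>
      (\<forall>U\<in>koszul_basis (length as) 1. koszul_delta as \<phi> U = \<zero>) \<longrightarrow> \<phi> {} = \<zero>"
      and f: "f \<in> carrier R" "\<forall>i<length as. as ! i \<otimes> f = \<zero>"
    show "f = \<zero>" using *[rule_format, of "\<lambda>_. f"] delta[of "\<lambda>_. f"] f by simp
  next
    fix \<phi> :: "nat set \<Rightarrow> 'a"
    assume *: "\<forall>f\<in>carrier R. (\<forall>i<length as. as ! i \<otimes> f = \<zero>) \<longrightarrow> f = \<zero>"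
      and \<phi>: "\<phi> {} \<in> carrier R" "\<forall>U\<in>koszul_basis (length as) 1. koszul_delta as \<phi> U = \<zero>"
    show "\<phi> {} = \<zero>" using * \<phi> delta[of \<phi>] by blast
  qed
qed

lemma koszul_exact_1_iff_syzygies:
  assumes as: "set as \<subseteq> carrier R"
  shows "koszul_exact as (Suc 0) \<longleftrightarrow>
    (\<forall>p. (\<forall>i<length as. p i \<in> carrier R) \<longrightarrow>
      (\<forall>j<length as. \<forall>i<j. as ! i \<otimes> p j \<ominus> as ! j \<otimes> p i = \<zero>) \<longrightarrow>
      (\<exists>r\<in>carrier R. \<forall>i<length as. p i = as ! i \<otimes> r))"
proof -
  let ?n = "length as"
  have a: "as ! i \<in> carrier R" if "i < ?n" for i using as that nth_mem by blast
  have cocycle: "(\<forall>U\<in>koszul_basis ?n (Suc (Suc 0)). koszul_delta as \<phi> U = \<zero>) \<longleftrightarrow>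
      (\<forall>j<?n. \<forall>i<j. as ! i \<otimes> \<phi> {j} \<ominus> as ! j \<otimes> \<phi> {i} = \<zero>)"
    if \<phi>: "\<And>i. i < ?n \<Longrightarrow> \<phi> {i} \<in> carrier R" for \<phi>
  proof -
    have delta: "koszul_delta as \<phi> {i, j} = as ! i \<otimes> \<phi> {j} \<ominus> as ! j \<otimes> \<phi> {i}"
      if "i < j" "j < ?n" for i j
      using that by (intro koszul_delta_pair a \<phi>) auto
    have pairs: "(\<forall>U\<in>koszul_basis ?n (Suc (Suc 0)). P U) \<longleftrightarrow> (\<forall>j<?n. \<forall>i<j. P {i, j})" for P
      unfolding koszul_basis_2 by blast
    show ?thesis unfolding pairs using delta by (intro all_cong1 imp_cong refl) simp
  qed
  have coboundary: "(\<exists>\<psi>. (\<forall>T\<in>koszul_basis ?n 0. \<psi> T \<in> carrier R) \<and>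
        (\<forall>U\<in>koszul_basis ?n (Suc 0). \<phi> U = koszul_delta as \<psi> U)) \<longleftrightarrow>
      (\<exists>r\<in>carrier R. \<forall>i<?n. \<phi> {i} = as ! i \<otimes> r)" (is "?L \<longleftrightarrow> ?R") for \<phi>
  proof
    assume ?L
    then obtain \<psi> where "\<psi> {} \<in> carrier R" "\<forall>i<?n. \<phi> {i} = koszul_delta as \<psi> {i}"
      by (auto simp: koszul_basis_0 koszul_basis_1)
    then show ?R using koszul_delta_singleton[OF a, of _ \<psi>] by auto
  next
    assume ?R
    then obtain r where "r \<in> carrier R" "\<forall>i<?n. \<phi> {i} = as ! i \<otimes> r" by blast
    then show ?L using koszul_delta_singleton[OF a, of _ "\<lambda>_. r"]
      by (intro exI[of _ "\<lambda>_. r"]) (auto simp: koszul_basis_1)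
  qed
  show ?thesis
    unfolding koszul_exact_Suc_iff[OF as] coboundary
  proof (intro iffI allI impI)
    fix p :: "nat \<Rightarrow> 'a"
    assume *: "\<forall>\<phi>. (\<forall>T\<in>koszul_basis ?n (Suc 0). \<phi> T \<in> carrier R) \<longrightarrow>
        (\<forall>U\<in>koszul_basis ?n (Suc (Suc 0)). koszul_delta as \<phi> U = \<zero>) \<longrightarrow>
        (\<exists>r\<in>carrier R. \<forall>i<?n. \<phi> {i} = as ! i \<otimes> r)"
      and p: "\<forall>i<?n. p i \<in> carrier R" "\<forall>j<?n. \<forall>i<j. as ! i \<otimes> p j \<ominus> as ! j \<otimes> p i = \<zero>"
    show "\<exists>r\<in>carrier R. \<forall>i<?n. p i = as ! i \<otimes> r"
    proof -
      let ?\<phi> = "\<lambda>T. p (the_elem T)"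
      have "\<forall>U\<in>koszul_basis ?n (Suc (Suc 0)). koszul_delta as ?\<phi> U = \<zero>"
        using cocycle[of ?\<phi>] p by simp
      moreover have "\<forall>T\<in>koszul_basis ?n (Suc 0). ?\<phi> T \<in> carrier R"
        using p(1) by (auto simp: koszul_basis_1)
      ultimately have "\<exists>r\<in>carrier R. \<forall>i<?n. ?\<phi> {i} = as ! i \<otimes> r"
        using *[THEN spec[of _ ?\<phi>]] by simp
      then show ?thesis by simp
    qed
  next
    fix \<phi> :: "nat set \<Rightarrow> 'a"
    assume *: "\<forall>p. (\<forall>i<?n. p i \<in> carrier R) \<longrightarrow>
        (\<forall>j<?n. \<forall>i<j. as ! i \<otimes> p j \<ominus> as ! j \<otimes> p i = \<zero>) \<longrightarrow>
        (\<exists>r\<in>carrier R. \<forall>i<?n. p i = as ! i \<otimes> r)"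
      and \<phi>: "\<forall>T\<in>koszul_basis ?n (Suc 0). \<phi> T \<in> carrier R"
        "\<forall>U\<in>koszul_basis ?n (Suc (Suc 0)). koszul_delta as \<phi> U = \<zero>"
    have \<phi>c: "\<And>i. i < ?n \<Longrightarrow> \<phi> {i} \<in> carrier R" using \<phi>(1) by (auto simp: koszul_basis_1)
    show "\<exists>r\<in>carrier R. \<forall>i<?n. \<phi> {i} = as ! i \<otimes> r"
    proof (rule *[THEN spec[of _ "\<lambda>i. \<phi> {i}"], THEN mp, THEN mp])
      show "\<forall>i<?n. \<phi> {i} \<in> carrier R" using \<phi>c by blast
      show "\<forall>j<?n. \<forall>i<j. as ! i \<otimes> \<phi> {j} \<ominus> as ! j \<otimes> \<phi> {i} = \<zero>"
        using cocycle[of \<phi>, OF \<phi>c] \<phi>(2) by (rule iffD1)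
    qed
  qed
qed

lemma koszul_exact_2_primitive:
  assumes as: "set as \<subseteq> carrier R" and exact: "koszul_exact as (Suc (Suc 0))"
    and w: "\<And>i j. i < j \<Longrightarrow> j < length as \<Longrightarrow> w i j \<in> carrier R"
    and cocycle: "\<And>i j k. i < j \<Longrightarrow> j < k \<Longrightarrow> k < length as \<Longrightarrow>
      as ! i \<otimes> w j k \<ominus> as ! j \<otimes> w i k \<oplus> as ! k \<otimes> w i j = \<zero>"
  obtains z where "\<And>i. i < length as \<Longrightarrow> z i \<in> carrier R"
    "\<And>i j. i < j \<Longrightarrow> j < length as \<Longrightarrow> w i j = as ! i \<otimes> z j \<ominus> as ! j \<otimes> z i"
proof -
  let ?n = "length as"
  have a: "as ! i \<in> carrier R" if "i < ?n" for i using as that nth_mem by blast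
  \<comment> \<open>An alternating family indexed by pairs \<open>i < j\<close>, as a function of two-element sets.\<close>
  let ?\<phi> = "\<lambda>T. w (Min T) (Max T)"
  have \<phi>: "?\<phi> {i, j} = w i j" if "i < j" for i j
    using that by simp
  have "koszul_delta as ?\<phi> U = \<zero>" if U3: "U \<in> koszul_basis ?n (Suc (Suc (Suc 0)))" for U
  proof -
    obtain i j k where U: "U = {i, j, k}" and ijk: "i < j" "j < k" "k < ?n"
      using koszul_basis_3[OF U3] by metis
    have "?\<phi> {j, k} = w j k" "?\<phi> {i, k} = w i k" "?\<phi> {i, j} = w i j"
      using ijk by simp_all
    then show ?thesis
      using koszul_delta_triple[OF ijk(1,2) a a a, of ?\<phi>] ijk w cocycle[OF ijk] by (simp add: U)
  qed
  moreover have "?\<phi> T \<in> carrier R" if "T \<in> koszul_basis ?n (Suc (Suc 0))" for T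
    using that w \<phi> unfolding koszul_basis_2 by force
  ultimately obtain \<psi> where \<psi>: "\<forall>T\<in>koszul_basis ?n (Suc 0). \<psi> T \<in> carrier R"
    and eq: "\<forall>U\<in>koszul_basis ?n (Suc (Suc 0)). ?\<phi> U = koszul_delta as \<psi> U"
    using exact[unfolded koszul_exact_Suc_iff[OF as], rule_format, of ?\<phi>] by blast
  have \<psi>': "\<psi> {i} \<in> carrier R" if "i < ?n" for i using \<psi> that by (auto simp: koszul_basis_1)
  show ?thesis
  proof (rule that[of "\<lambda>i. \<psi> {i}"])
    fix i j assume ij: "i < j" "j < ?n"
    then have "{i, j} \<in> koszul_basis ?n (Suc (Suc 0))" unfolding koszul_basis_2 by blast
    then have "w i j = koszul_delta as \<psi> {i, j}" using eq \<phi>[OF ij(1)] by metis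
    then show "w i j = as ! i \<otimes> \<psi> {j} \<ominus> as ! j \<otimes> \<psi> {i}"
      using koszul_delta_pair[where \<phi> = \<psi>, OF ij(1) a a \<psi>' \<psi>'] ij by simp
  qed (rule \<psi>')
qed

text \<open>
Write the sequence as \<open>a = c u + d v\<close> and let \<open>w = u \<and> v\<close>. Then \<open>a \<and> w = 0\<close>, while
\<open>a \<and> v = c w\<close> and \<open>a \<and> u = - d w\<close>. If the cohomology vanishes in degree 2, then \<open>w = a \<and> z\<close>, so
\<open>v - c z\<close> and \<open>u + d z\<close> are 1-cocycles. If it vanishes in degree 1, they are \<open>q a\<close> and \<open>r a\<close>, and
\<open>a = c u + d v = c (u + d z) + d (v - c z) = (c r + d q) a\<close>. If it also vanishes in degree 0, it follows
that \<open>c r + d q = 1\<close>.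
\<close>

lemma koszul_not_exact_in_two_generated_ideal:
  assumes as: "set as \<subseteq> carrier R"
    and cd: "c \<in> carrier R" "d \<in> carrier R"
    and gen: "\<And>a. a \<in> set as \<Longrightarrow> \<exists>u\<in>carrier R. \<exists>v\<in>carrier R. a = c \<otimes> u \<oplus> d \<otimes> v"
    and proper: "\<And>u v. u \<in> carrier R \<Longrightarrow> v \<in> carrier R \<Longrightarrow> c \<otimes> u \<oplus> d \<otimes> v \<noteq> \<one>"
  shows "\<exists>p\<le>2. \<not> koszul_exact as p"
proof (rule ccontr)
  assume "\<not> (\<exists>p\<le>2. \<not> koszul_exact as p)"
  then have exact: "koszul_exact as 0" "koszul_exact as (Suc 0)" "koszul_exact as (Suc (Suc 0))"
    by auto
  let ?n = "length as"
  have a: "as ! i \<in> carrier R" if "i < ?n" for i using as that nth_mem by blast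
  have "\<forall>i. \<exists>u v. i < ?n \<longrightarrow> u \<in> carrier R \<and> v \<in> carrier R \<and> as ! i = c \<otimes> u \<oplus> d \<otimes> v"
    using gen nth_mem by blast
  then obtain u v where u: "\<And>i. i < ?n \<Longrightarrow> u i \<in> carrier R" and v: "\<And>i. i < ?n \<Longrightarrow> v i \<in> carrier R"
    and auv: "\<And>i. i < ?n \<Longrightarrow> as ! i = c \<otimes> u i \<oplus> d \<otimes> v i" by metis
  obtain z where z: "\<And>i. i < ?n \<Longrightarrow> z i \<in> carrier R"
    and wz: "\<And>i j. i < j \<Longrightarrow> j < ?n \<Longrightarrow> u i \<otimes> v j \<ominus> u j \<otimes> v i = as ! i \<otimes> z j \<ominus> as ! j \<otimes> z i"
  proof (rule koszul_exact_2_primitive[OF as exact(3), of "\<lambda>i j. u i \<otimes> v j \<ominus> u j \<otimes> v i"])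
    fix i j k assume "i < j" "j < k" "k < ?n"
    then have [simp]: "i < ?n" "j < ?n" "k < ?n" by auto
    have c: "u i \<in> carrier R" "u j \<in> carrier R" "u k \<in> carrier R"
      "v i \<in> carrier R" "v j \<in> carrier R" "v k \<in> carrier R" by (simp_all add: u v)
    show "as ! i \<otimes> (u j \<otimes> v k \<ominus> u k \<otimes> v j) \<ominus> as ! j \<otimes> (u i \<otimes> v k \<ominus> u k \<otimes> v i)
        \<oplus> as ! k \<otimes> (u i \<otimes> v j \<ominus> u j \<otimes> v i) = \<zero>"
      unfolding auv[OF \<open>i < ?n\<close>] auv[OF \<open>j < ?n\<close>] auv[OF \<open>k < ?n\<close>]
      using c cd by algebra
  qed (use u v in \<open>auto intro!: minus_closed m_closed\<close>)
  have "\<exists>q\<in>carrier R. \<forall>i<?n. v i \<ominus> c \<otimes> z i = as ! i \<otimes> q"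
  proof (rule exact(2)[unfolded koszul_exact_1_iff_syzygies[OF as], rule_format])
    fix i j assume j: "j < ?n" and ij: "i < j"
    then have i: "i < ?n" by simp
    note c = cd u[OF i] u[OF j] v[OF i] v[OF j] z[OF i] z[OF j] a[OF i] a[OF j]
    have "as ! i \<otimes> (v j \<ominus> c \<otimes> z j) \<ominus> as ! j \<otimes> (v i \<ominus> c \<otimes> z i)
        = as ! i \<otimes> v j \<ominus> as ! j \<otimes> v i \<ominus> c \<otimes> (as ! i \<otimes> z j \<ominus> as ! j \<otimes> z i)"
      using c by algebra
    also have "\<dots> = as ! i \<otimes> v j \<ominus> as ! j \<otimes> v i \<ominus> c \<otimes> (u i \<otimes> v j \<ominus> u j \<otimes> v i)"
      by (simp only: wz[OF ij j])
    also have "\<dots> = \<zero>" unfolding auv[OF i] auv[OF j] using c(1-6) by algebra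
    finally show "as ! i \<otimes> (v j \<ominus> c \<otimes> z j) \<ominus> as ! j \<otimes> (v i \<ominus> c \<otimes> z i) = \<zero>" .
  qed (use v z cd in auto)
  then obtain q where q: "q \<in> carrier R" "\<And>i. i < ?n \<Longrightarrow> v i \<ominus> c \<otimes> z i = as ! i \<otimes> q" by blast
  have "\<exists>r\<in>carrier R. \<forall>i<?n. u i \<oplus> d \<otimes> z i = as ! i \<otimes> r"
  proof (rule exact(2)[unfolded koszul_exact_1_iff_syzygies[OF as], rule_format])
    fix i j assume j: "j < ?n" and ij: "i < j"
    then have i: "i < ?n" by simp
    note c = cd u[OF i] u[OF j] v[OF i] v[OF j] z[OF i] z[OF j] a[OF i] a[OF j]
    have "as ! i \<otimes> (u j \<oplus> d \<otimes> z j) \<ominus> as ! j \<otimes> (u i \<oplus> d \<otimes> z i)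
        = as ! i \<otimes> u j \<ominus> as ! j \<otimes> u i \<oplus> d \<otimes> (as ! i \<otimes> z j \<ominus> as ! j \<otimes> z i)"
      using c by algebra
    also have "\<dots> = as ! i \<otimes> u j \<ominus> as ! j \<otimes> u i \<oplus> d \<otimes> (u i \<otimes> v j \<ominus> u j \<otimes> v i)"
      by (simp only: wz[OF ij j])
    also have "\<dots> = \<zero>" unfolding auv[OF i] auv[OF j] using c(1-6) by algebra
    finally show "as ! i \<otimes> (u j \<oplus> d \<otimes> z j) \<ominus> as ! j \<otimes> (u i \<oplus> d \<otimes> z i) = \<zero>" .
  qed (use u z cd in auto)
  then obtain r where r: "r \<in> carrier R" "\<And>i. i < ?n \<Longrightarrow> u i \<oplus> d \<otimes> z i = as ! i \<otimes> r" by blast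
  let ?f = "\<one> \<ominus> (c \<otimes> r \<oplus> d \<otimes> q)"
  have "as ! i \<otimes> ?f = \<zero>" if i: "i < ?n" for i
  proof -
    note c = cd u[OF i] v[OF i] z[OF i] a[OF i] q(1) r(1)
    have "as ! i \<otimes> ?f = as ! i \<ominus> c \<otimes> (as ! i \<otimes> r) \<ominus> d \<otimes> (as ! i \<otimes> q)"
      using c by algebra
    also have "\<dots> = as ! i \<ominus> c \<otimes> (u i \<oplus> d \<otimes> z i) \<ominus> d \<otimes> (v i \<ominus> c \<otimes> z i)"
      by (simp only: q(2)[OF i] r(2)[OF i])
    also have "\<dots> = \<zero>" unfolding auv[OF i] using c(1-5) by algebra
    finally show ?thesis .
  qed
  moreover have f: "?f \<in> carrier R" using cd q(1) r(1) by simp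
  ultimately have "?f = \<zero>" using exact(1) unfolding koszul_exact_0_iff_annihilator[OF as] by blast
  then have "c \<otimes> r \<oplus> d \<otimes> q = \<one>"
    using cd q(1) r(1) by (simp add: r_right_minus_eq)
  then show False using proper[OF r(1) q(1)] by blast
qed

section \<open>Grades of an annihilated ideal and of a two-generated ideal\<close>

lemma koszul_grade_annihilated:
  assumes z: "z \<in> carrier R" "z \<noteq> \<zero>" and ann: "\<And>a. a \<in> J \<Longrightarrow> a \<otimes> z = \<zero>"
  shows "koszul_grade R J (self_module R) = 0"
proof -
  have "koszul_grade_seq R as (self_module R) \<le> 0"
    if as: "set as \<subseteq> carrier R" and J: "Idl (set as) \<subseteq> J" for as
  proof -
    have "as ! i \<otimes> z = \<zero>" if "i < length as" for i
      by (rule ann, rule subsetD[OF J], rule subsetD[OF genideal_self[OF as]], rule nth_mem[OF that])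
    then have "\<not> koszul_exact as 0" unfolding koszul_exact_0_iff_annihilator[OF as] using z by blast
    then show ?thesis
      unfolding koszul_grade_seq_eq[OF as] by (intro Inf_lower) (auto simp: zero_enat_def)
  qed
  then have "koszul_grade R J (self_module R) \<le> 0"
    unfolding koszul_grade_def by (intro Sup_least) auto
  then show ?thesis by simp
qed

text \<open>
The last two hypotheses say that the Koszul cohomology of the sequence \<open>c, d\<close> vanishes in degrees 0 and 1,
so that the supremum reaches 2.
\<close>

lemma koszul_grade_two_generated:
  assumes J: "ideal J R" and cd: "c \<in> J" "d \<in> J" and proper: "\<one> \<notin> J"
    and gen: "\<And>a. a \<in> J \<Longrightarrow> \<exists>u\<in>carrier R. \<exists>v\<in>carrier R. a = c \<otimes> u \<oplus> d \<otimes> v"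
    and ann: "\<And>f. f \<in> carrier R \<Longrightarrow> c \<otimes> f = \<zero> \<Longrightarrow> d \<otimes> f = \<zero> \<Longrightarrow> f = \<zero>"
    and syz: "\<And>p q. p \<in> carrier R \<Longrightarrow> q \<in> carrier R \<Longrightarrow> c \<otimes> q = d \<otimes> p
      \<Longrightarrow> \<exists>r\<in>carrier R. p = c \<otimes> r \<and> q = d \<otimes> r"
  shows "koszul_grade R J (self_module R) = 2"
proof (rule antisym)
  interpret J: ideal J R by (rule J)
  have cdR: "c \<in> carrier R" "d \<in> carrier R" using cd J.a_subset by auto
  have "koszul_grade_seq R as (self_module R) \<le> 2"
    if as: "set as \<subseteq> carrier R" and le: "Idl (set as) \<subseteq> J" for as
  proof -
    have "\<exists>p\<le>2. \<not> koszul_exact as p"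
    proof (rule koszul_not_exact_in_two_generated_ideal[OF as cdR])
      show "\<exists>u\<in>carrier R. \<exists>v\<in>carrier R. a = c \<otimes> u \<oplus> d \<otimes> v" if "a \<in> set as" for a
        by (rule gen, rule subsetD[OF le], rule subsetD[OF genideal_self[OF as] that])
      show "c \<otimes> u \<oplus> d \<otimes> v \<noteq> \<one>" if "u \<in> carrier R" "v \<in> carrier R" for u v
        using J.a_closed[OF J.I_r_closed[OF cd(1) that(1)] J.I_r_closed[OF cd(2) that(2)]] proper
        by metis
    qed
    then obtain p where p: "p \<le> 2" "\<not> koszul_exact as p" by blast
    have "koszul_grade_seq R as (self_module R) \<le> enat p"
      unfolding koszul_grade_seq_eq[OF as] using p(2) by (intro Inf_lower) blast
    also have "\<dots> \<le> 2" using p(1) by (simp add: numeral_eq_enat)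
    finally show ?thesis .
  qed
  then show "koszul_grade R J (self_module R) \<le> 2"
    unfolding koszul_grade_def by (intro Sup_least) auto
next
  interpret J: ideal J R by (rule J)
  have cdR: "c \<in> carrier R" "d \<in> carrier R" using cd J.a_subset by auto
  let ?as = "[c, d]"
  have as: "set ?as \<subseteq> carrier R" using cdR by simp
  have "koszul_exact ?as 0"
    unfolding koszul_exact_0_iff_annihilator[OF as] using ann by (auto simp: less_Suc_eq)
  moreover have "koszul_exact ?as (Suc 0)"
    unfolding koszul_exact_1_iff_syzygies[OF as]
  proof (intro allI impI)
    fix p :: "nat \<Rightarrow> 'a"
    assume p: "\<forall>i<length ?as. p i \<in> carrier R"
      and "\<forall>j<length ?as. \<forall>i<j. ?as ! i \<otimes> p j \<ominus> ?as ! j \<otimes> p i = \<zero>"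
    then have "c \<otimes> p 1 \<ominus> d \<otimes> p 0 = \<zero>" by (auto simp: less_Suc_eq)
    moreover have p01: "p 0 \<in> carrier R" "p 1 \<in> carrier R" using p by auto
    ultimately have "c \<otimes> p 1 = d \<otimes> p 0" using cdR by (simp add: r_right_minus_eq)
    then show "\<exists>r\<in>carrier R. \<forall>i<length ?as. p i = ?as ! i \<otimes> r"
      using syz[OF p01] by (auto simp: less_Suc_eq)
  qed
  ultimately have "i \<noteq> 0 \<and> i \<noteq> Suc 0" if "\<not> koszul_exact ?as i" for i
    using that by metis
  then have "2 \<le> i" if "\<not> koszul_exact ?as i" for i
    using that by (metis One_nat_def less_2_cases not_le)
  then have "2 \<le> koszul_grade_seq R ?as (self_module R)"
    unfolding koszul_grade_seq_eq[OF as] by (intro Inf_greatest) (auto simp: numeral_eq_enat)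
  also have "\<dots> \<le> koszul_grade R J (self_module R)"
    unfolding koszul_grade_def
  proof (rule Sup_upper, rule CollectI, intro exI conjI)
    show "ideal (Idl (set ?as)) R" by (rule genideal_ideal[OF as])
    show "Idl (set ?as) \<subseteq> J" using cd by (intro genideal_minimal[OF J]) simp
    show "set ?as \<subseteq> carrier R" by (rule as)
  qed (rule refl)+
  finally show "2 \<le> koszul_grade R J (self_module R)" .
qed

end

section \<open>The plane with a thickened origin\<close>

abbreviation eval_origin :: "'k::field poly poly \<Rightarrow> 'k" where
  "eval_origin f \<equiv> poly (poly f 0) 0"

lemma type_ring_hom_eval_origin: "type_ring_hom (eval_origin :: 'k::field poly poly \<Rightarrow> 'k)"
  by unfold_locales auto

lemma noetherian_polynomial_extension:
  "noetherian_ring (trivial_extension (eval_origin :: 'k::field poly poly \<Rightarrow> 'k))"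
proof (rule type_ring_hom.noetherian_S[OF type_ring_hom_eval_origin])
  show "finitely_generated I" if "ideals.subspace I" for I :: "'k poly poly set"
    by (rule Hilbert_basis[OF Hilbert_basis[OF field_ideal_finitely_generated] that])
  show "c dvd 1" if "c \<noteq> 0" for c :: 'k
    by (rule dvdI[of _ _ "inverse c"]) (use that in simp)
  show "surj (eval_origin :: 'k poly poly \<Rightarrow> 'k)"
    by (rule surjI[where f = "\<lambda>c. [:[:c:]:]"]) simp
qed

text \<open>
The line passes through the origin, so its ideal kills the element \<open>(0, 1)\<close>, which is supported there.
\<close>

lemma koszul_grade_line:
  "koszul_grade (trivial_extension eval_origin) (fst -` line_ideal :: ('k::field poly poly \<times> 'k) set)
    (self_module (trivial_extension eval_origin)) = 0"
proof -
  interpret type_ring_hom "eval_origin :: 'k poly poly \<Rightarrow> 'k" by (rule type_ring_hom_eval_origin)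
  show ?thesis
    by (rule S.koszul_grade_annihilated[of "(0, 1)"]) (auto simp: line_ideal_def)
qed

text \<open>
Because \<open>b \<noteq> 0\<close>, the function \<open>x - b\<close> does not vanish at the origin and is invertible on the second
summand. This gives the three points used below: the second summand lies in the ideal generated by \<open>x - b\<close>
and \<open>y\<close>, the element \<open>x - b\<close> is a nonzerodivisor, and a syzygy of \<open>(x - b, y)\<close> reduces to one over the
polynomial ring, where \<open>x - b\<close> and \<open>y\<close> are coprime.
\<close>

lemma koszul_grade_point:
  assumes "b \<noteq> 0"
  shows "koszul_grade (trivial_extension eval_origin)
    (fst -` point_ideal b :: ('k::field poly poly \<times> 'k) set)
    (self_module (trivial_extension eval_origin)) = 2"
proof -
  interpret type_ring_hom "eval_origin :: 'k poly poly \<Rightarrow> 'k" by (rule type_ring_hom_eval_origin)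
  let ?X = "[:[:-b, 1:]:] :: 'k poly poly" and ?Y = "[:0, 1:] :: 'k poly poly"
  have eX: "eval_origin ?X = - b" and eY: "eval_origin ?Y = 0" by simp_all
  have Q: "primeideal (fst -` point_ideal b) S"
    by (rule primeideal_S[OF prime_point_ideal])
  show ?thesis
  proof (rule S.koszul_grade_two_generated[of _ "(?X, 0)" "(?Y, 0)"])
    show "ideal (fst -` point_ideal b) S" by (rule primeideal.axioms(1)[OF Q])
    show "(?X, 0) \<in> fst -` point_ideal b" "(?Y, 0) \<in> fst -` point_ideal b"
      by (simp_all add: point_ideal_def)
    show "\<one>\<^bsub>S\<^esub> \<notin> fst -` point_ideal b" by (simp add: point_ideal_def)
  next
    fix z :: "'k poly poly \<times> 'k" assume "z \<in> fst -` point_ideal b"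
    then obtain u v where "fst z = ?X * u + ?Y * v" using point_ideal_generators[of "fst z" b] by auto
    then have "z = (?X, 0) \<otimes>\<^bsub>S\<^esub> (u, - snd z / b) \<oplus>\<^bsub>S\<^esub> (?Y, 0) \<otimes>\<^bsub>S\<^esub> (v, 0)"
      using assms by (simp add: prod_eq_iff eX eY del: mult_pCons_left)
    then show "\<exists>u\<in>carrier S. \<exists>v\<in>carrier S. z = (?X, 0) \<otimes>\<^bsub>S\<^esub> u \<oplus>\<^bsub>S\<^esub> (?Y, 0) \<otimes>\<^bsub>S\<^esub> v"
      unfolding S_simps(1) by blast
  next
    fix f assume "(?X, 0) \<otimes>\<^bsub>S\<^esub> f = \<zero>\<^bsub>S\<^esub>"
    then show "f = \<zero>\<^bsub>S\<^esub>" using assms by (simp add: prod_eq_iff eX del: mult_pCons_left)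
  next
    fix p q assume "(?X, 0) \<otimes>\<^bsub>S\<^esub> q = (?Y, 0) \<otimes>\<^bsub>S\<^esub> p"
    then have eq: "?X * fst q = ?Y * fst p" and q: "snd q = 0"
      using assms by (simp_all add: eX eY del: mult_pCons_left)
    have "poly ?X 0 * poly (fst q) 0 = poly ?Y 0 * poly (fst p) 0"
      using eq by (metis poly_mult)
    moreover have "poly ?X 0 \<noteq> 0" "poly ?Y 0 = 0" by simp_all
    ultimately have "poly (fst q) 0 = 0" by (metis mult_zero_left mult_eq_0_iff)
    then obtain r where r: "fst q = ?Y * r"
      using poly_eq_0_iff_dvd[of "fst q" 0] by (auto elim: dvdE)
    have "?Y * (?X * r) = ?Y * fst p" using eq unfolding r by (simp only: mult.left_commute)
    then have "fst p = ?X * r" by (metis mult_left_cancel pCons_eq_0_iff one_neq_zero)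
    then have "p = (?X, 0) \<otimes>\<^bsub>S\<^esub> (r, - snd p / b)" "q = (?Y, 0) \<otimes>\<^bsub>S\<^esub> (r, - snd p / b)"
      using r q assms by (simp_all add: prod_eq_iff eX eY del: mult_pCons_left)
    then show "\<exists>r\<in>carrier S. p = (?X, 0) \<otimes>\<^bsub>S\<^esub> r \<and> q = (?Y, 0) \<otimes>\<^bsub>S\<^esub> r"
      unfolding S_simps(1) by blast
  qed
qed

theorem proposition3p9:
  shows "\<exists>(S :: witness_elem ring) P Q.
    cring S \<and> noetherian_ring S \<and>
    primeideal P S \<and> primeideal Q S \<and> P \<subset> Q \<and>
    prime_height S Q = prime_height S P + 1 \<and>
    koszul_grade S Q (self_module S) > koszul_grade S P (self_module S) + 1 \<and>
    koszul_grade S P (self_module S) = 0 \<and>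
    koszul_grade S Q (self_module S) = 2"
proof -
  interpret type_ring_hom "eval_origin :: rat poly poly \<Rightarrow> rat" by (rule type_ring_hom_eval_origin)
  let ?P = "over line_ideal" and ?Q = "over (point_ideal 1)"
  have ht: "prime_height S ?P = 1" "prime_height S ?Q = 2"
    by (rule prime_height_line[OF type_ring_hom_eval_origin], rule prime_height_point[OF type_ring_hom_eval_origin])
  have gr: "koszul_grade S ?P (self_module S) = 0" "koszul_grade S ?Q (self_module S) = 2"
    by (rule koszul_grade_line, rule koszul_grade_point) simp
  show ?thesis
  proof (intro exI conjI)
    show "cring S" by (rule cring_S)
    show "noetherian_ring S" by (rule noetherian_polynomial_extension)
    show "primeideal ?P S" by (rule primeideal_S[OF prime_line_ideal])
    show "primeideal ?Q S" by (rule primeideal_S[OF prime_point_ideal])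
    show "?P \<subset> ?Q" by (simp only: fst_vimage_psubset_iff line_subset_point)
    show "prime_height S ?Q = prime_height S ?P + 1" unfolding ht by simp
    show "koszul_grade S ?P (self_module S) + 1 < koszul_grade S ?Q (self_module S)"
      unfolding gr by (simp add: one_enat_def numeral_eq_enat)
  qed (rule gr)+
qed

end
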